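(* Let $Z_{\rm Pell}(s)=\sum_{n\ge1}\mathsf P_n^{-s}$ for $\operatorname{Re}s>0$, where $(\mathsf P_n)$ is the Pell sequence. There is a unique $\sigma_{\rm Pell}>0$ satisfying $Z_{\rm Pell}(\sigma_{\rm Pell})=2$. Numerically, $\sigma_{\rm Pell}=0.875850904477574106444461159947\ldots$. Moreover, $Z_{\rm Pell}(s)\ne0$ for $\operatorname{Re}s\ge\sigma_{\rm Pell}$, and $$\overline{\{\operatorname{Re}\rho: Z_{\rm Pell}(\rho)=0,\ \operatorname{Re}\rho>0\}}=[0,\sigma_{\rm Pell}].$$ No zero lies on the boundary line $\operatorname{Re}s=\sigma_{\rm Pell}$.
   Context: The Pell sequence is $\mathsf P_0=0$, $\mathsf P_1=1$, $\mathsf P_{n+2}=2\mathsf P_{n+1}+\mathsf P_n$. The overline denotes closure in $\mathbb R$. *)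

theory Defs
  imports "HOL-Analysis.Analysis"
begin

fun pell :: "nat \<Rightarrow> nat" where
  "pell 0 = 0"
| "pell (Suc 0) = 1"
| "pell (Suc (Suc n)) = 2 * pell (Suc n) + pell n"

text \<open>
  The index is shifted, so that the sum starts with \<open>P\<^sub>1 = 1\<close>. The definition is meaningful
  only where the series converges, in particular for \<open>Re s > 0\<close>; see \<open>summable_pell\<close> below.
\<close>

definition Z_Pell :: "complex \<Rightarrow> complex" where
  "Z_Pell s = (\<Sum>n. of_nat (pell (Suc n)) powr (- s))"

lemma pell_ge_two_power: "2 ^ n \<le> pell (Suc n)"
proof (induction n)
  case (Suc n)
  then show ?case by simp
qed simp

lemma summable_pell:
  assumes "Re s > 0"
  shows "summable (\<lambda>n. norm (of_nat (pell (Suc n)) powr (- s) :: complex))"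
proof (rule summable_comparison_test)
  show "summable (\<lambda>n. (2 powr (- Re s)) ^ n :: real)"
    using assms by (intro summable_geometric) (simp add: powr_less_one)
  have "norm (of_nat (pell (Suc n)) powr (- s) :: complex) \<le> (2 powr (- Re s)) ^ n" for n
  proof -
    have ge: "2 ^ n \<le> real (pell (Suc n))"
      using pell_ge_two_power[of n] by (metis of_nat_le_iff of_nat_numeral of_nat_power)
    have "norm (of_nat (pell (Suc n)) powr (- s) :: complex) = real (pell (Suc n)) powr (- Re s)"
      by (subst norm_powr_real_powr) auto
    also have "\<dots> \<le> (2 ^ n) powr (- Re s)"
      using ge assms by (intro powr_mono2') auto
    also have "\<dots> = (2 powr (- Re s)) ^ n"
      by (simp add: powr_powr powr_realpow [symmetric] powr_power mult.commute)
    finally show ?thesis .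
  qed
  then show "\<exists>N. \<forall>n\<ge>N. norm (norm (of_nat (pell (Suc n)) powr (- s) :: complex)) \<le> (2 powr (- Re s)) ^ n"
    by auto
qed

end

theory Submission
  imports Defs "HOL-Complex_Analysis.Complex_Analysis" "HOL-Number_Theory.Totient"
begin

text \<open>
  For \<open>0 < x < \<sigma>\<close> the value \<open>Z(x)\<close> exceeds 2, so the leading term 1 is smaller than the sum of the
  other terms; hence unimodular phases \<open>c\<^sub>n\<close> with \<open>\<Sum> c\<^sub>n P\<^sub>n\<^sup>-\<^sup>x = 0\<close>
  exist. Every \<open>P\<^sub>n\<close> with \<open>n \<ge> 2\<close> has a primitive prime divisor, so the numbers \<open>ln P\<^sub>n\<close> are linearly
  independent over the rationals, and Kronecker's theorem makes vertical translates of \<open>Z\<close> converge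
  locally uniformly to \<open>\<Sum> c\<^sub>n P\<^sub>n\<^sup>-\<^sup>s\<close>. By Hurwitz's theorem, \<open>Z\<close> has zeros with real part
  arbitrarily close to \<open>x\<close>.

  The digits of \<open>\<sigma>\<close> come from Binet's formula: with \<open>\<alpha> = 1 + \<surd>2\<close>, \<open>u = \<alpha>\<^sup>-\<^sup>s\<close> and \<open>y = \<alpha>\<^sup>-\<^sup>2\<close> the binomial
  series turns \<open>Z(s)\<close> into \<open>(2\<surd>2)\<^sup>s \<Sum>\<^sub>k (s)\<^sub>k/k! \<cdot> w\<^sub>k/(1 - w\<^sub>k)\<close> with \<open>w\<^sub>k = u (-y)\<^sup>k\<close>, of which
  42 terms are evaluated in fixed-point arithmetic inside the kernel.
\<close>

section \<open>Fixed-point evaluation\<close>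

text \<open>The threshold is 2 because the term of P_1 = 1 is unchanged by every vertical
  translation: the other terms can cancel it only while their absolute sum Z(x) - 1 is at least 1.
  Since ln P_1 = 0, Kronecker's theorem is applied from P_2 on.

  Primitive divisors exist without exceptional indices because \<alpha> - |\<beta>| = 2 for the
  roots \<alpha> = 1 + sqrt 2 and \<beta> = 1 - sqrt 2: this makes the cyclotomic values too large
  to consist of primes dividing n alone.

  The thirty digits amount to Z(a) > 2 > Z(b) at two consecutive decimals. Summing the series
  directly would need a new real power for each index. After the Binet expansion only two
  exponentials per argument remain, and the terms follow from rational recurrences that shrink by
  the factor y, about 0.17. The error bounds are proved for the very integer functions that are
  executed.\<close>

definition fx_one :: int where "fx_one = 340282366920938463463374607431768211456"

lemma fx_one: "fx_one = 2 ^ 128"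
  by (simp add: fx_one_def)

text \<open>
  The integer \<open>X\<close> stands for \<open>X / 2\<^sup>1\<^sup>2\<^sup>8\<close>, with the error \<open>e\<close> counted in units of the last place.
\<close>

definition near :: "real \<Rightarrow> int \<Rightarrow> real \<Rightarrow> bool" where
  "near e X x \<longleftrightarrow> \<bar>of_int X - x * of_int fx_one\<bar> \<le> e"

definition fx_shift :: "int \<Rightarrow> int" where "fx_shift X = drop_bit 128 X"

lemma fx_shift: "fx_shift X = X div fx_one"
  by (simp add: fx_shift_def fx_one drop_bit_eq_div)

lemma fx_one_pos: "fx_one > 0" "real_of_int fx_one > 0"
  by (simp_all add: fx_one_def)

lemma int_div_bounds:
  assumes "b > 0"
  shows "of_int (a div b) \<le> (of_int a / of_int b :: real)" "of_int (a div b) > (of_int a / of_int b - 1 :: real)"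
  unfolding floor_divide_of_int_eq[symmetric, where ?'a = real] by linarith+

text \<open>The error of the product splits into (X/D)(Y - y D) + y (X - x D) with D the scale, and
  rounding down adds 1. The bound \<open>q\<close> matters when y is small: it then damps the error
  of the other factor, which keeps the error constant in the recurrences below.\<close>

lemma near_mult:
  assumes "near e X x" "near f Y y" "0 \<le> X" "X \<le> fx_one" "0 \<le> y" "y \<le> q"
  shows "near (q * e + f + 1) (fx_shift (X * Y)) (x * y)"
proof -
  let ?D = "of_int fx_one :: real"
  let ?X = "of_int X :: real" and ?Y = "of_int Y :: real"
  have D: "?D > 0" by (rule fx_one_pos)
  define A B where "A = (?X / ?D) * (?Y - y * ?D)" and "B = y * (?X - x * ?D)"
  have "?X * ?Y / ?D - x * y * ?D = A + B"
    using D by (simp add: A_def B_def field_simps)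
  moreover have "\<bar>A\<bar> \<le> 1 * f"
    unfolding A_def abs_mult using assms D by (intro mult_mono) (auto simp: near_def)
  moreover have "\<bar>B\<bar> \<le> q * e"
    unfolding B_def abs_mult using assms D by (intro mult_mono) (auto simp: near_def)
  moreover have "of_int (fx_shift (X * Y)) \<le> ?X * ?Y / ?D" "of_int (fx_shift (X * Y)) > ?X * ?Y / ?D - 1"
    using int_div_bounds[OF fx_one_pos(1), of "X * Y"] by (simp_all add: fx_shift)
  ultimately show ?thesis unfolding near_def by linarith
qed

lemma near_int_div:
  assumes "b > 0" "\<bar>of_int a / of_int b - x * of_int fx_one\<bar> \<le> e"
  shows "near (e + 1) (a div b) x"
  using int_div_bounds[OF assms(1), of a] assms(2) unfolding near_def by linarith

lemma near_div:
  assumes "near e X x" "j > 0"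
  shows "near (e / of_int j + 1) (X div j) (x / of_int j)"
proof -
  have "\<bar>of_int X / of_int j - x / of_int j * of_int fx_one\<bar> = \<bar>of_int X - x * of_int fx_one\<bar> / (of_int j :: real)"
    using assms(2) by (simp flip: diff_divide_distrib)
  also have "\<dots> \<le> e / of_int j"
    using assms by (intro divide_right_mono) (auto simp: near_def)
  finally show ?thesis
    using int_div_bounds[OF assms(2), of X] unfolding near_def by linarith
qed

lemma near_mono: "near e X x \<Longrightarrow> e \<le> f \<Longrightarrow> near f X x"
  by (simp add: near_def)

section \<open>The exponential function in fixed point\<close>

fun nexp_horner :: "int \<Rightarrow> int \<Rightarrow> nat \<Rightarrow> int" where
  "nexp_horner X j 0 = fx_one"
| "nexp_horner X j (Suc n) = fx_one - fx_shift (X * nexp_horner X (j + 1) n) div j"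

fun nexp_poly :: "real \<Rightarrow> real \<Rightarrow> nat \<Rightarrow> real" where
  "nexp_poly x j 0 = 1"
| "nexp_poly x j (Suc n) = 1 - x * nexp_poly x (j + 1) n / j"

text \<open>The error does not grow with \<open>n\<close>: multiplying by x \<le> 1/256 shrinks the
  incoming 3, and (3/256 + 1)/j + 1 is at most 3 again.\<close>

lemma near_nexp_horner:
  assumes "0 \<le> X" "256 * X \<le> fx_one" "1 \<le> j"
  shows "near 3 (nexp_horner X j n) (nexp_poly (of_int X / of_int fx_one) (of_int j) n) \<and>
         0 \<le> nexp_horner X j n \<and> nexp_horner X j n \<le> fx_one"
  using assms(3)
proof (induction n arbitrary: j)
  case 0
  then show ?case using fx_one_pos by (simp add: near_def)
next
  case (Suc n)
  define x :: real where "x = of_int X / of_int fx_one"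
  define T where "T = nexp_horner X (j + 1) n"
  define t where "t = nexp_poly x (of_int (j + 1)) n"
  have IH: "near 3 T t" "0 \<le> T" "T \<le> fx_one"
    using Suc.IH[of "j + 1"] Suc.prems by (simp_all add: T_def t_def x_def add.commute)
  have x: "0 \<le> x" "x \<le> 1 / 256"
  proof -
    have "real_of_int (256 * X) \<le> of_int fx_one" using assms(2) of_int_le_iff by blast
    then show "0 \<le> x" "x \<le> 1 / 256"
      using assms(1) fx_one_pos(2) by (simp_all add: x_def field_simps)
  qed
  have "near 0 X x" using fx_one_pos(2) by (simp add: near_def x_def)
  then have "near (1/256 * 3 + 0 + 1) (fx_shift (T * X)) (t * x)"
    using near_mult[OF IH(1) _ IH(2,3) x, of 0 X] by simp
  then have "near ((1/256 * 3 + 0 + 1) / of_int j + 1) (fx_shift (T * X) div j) (t * x / of_int j)"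
    using near_div[of _ _ _ j] Suc.prems by fastforce
  moreover have "(1/256 * 3 + 0 + 1) / of_int j + 1 \<le> (3 :: real)"
    using Suc.prems by (simp add: field_simps)
  ultimately have "near 3 (fx_shift (T * X) div j) (t * x / of_int j)"
    using near_mono by blast
  then have "near 3 (fx_one - fx_shift (T * X) div j) (1 - t * x / of_int j)"
    unfolding near_def by (simp add: algebra_simps abs_minus_commute)
  moreover have "0 \<le> fx_shift (T * X) div j" "fx_shift (T * X) div j \<le> fx_one"
  proof -
    have "0 \<le> T * X" using IH assms by simp
    then show "0 \<le> fx_shift (T * X) div j"
      using Suc.prems fx_one_pos by (simp add: fx_shift pos_imp_zdiv_nonneg_iff)
    have "T * X \<le> fx_one * fx_one" using IH assms by (intro mult_mono) auto
    then have "fx_shift (T * X) \<le> fx_one"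
      using zdiv_mono1[OF _ fx_one_pos(1)] fx_one_pos unfolding fx_shift by fastforce
    moreover have "fx_shift (T * X) div j \<le> fx_shift (T * X)"
      using \<open>0 \<le> T * X\<close> Suc.prems fx_one_pos
      by (smt (verit) fx_shift int_div_less_self pos_imp_zdiv_nonneg_iff div_by_1 zdiv_mono2)
    ultimately show "fx_shift (T * X) div j \<le> fx_one" by linarith
  qed
  ultimately show ?case by (simp add: T_def t_def x_def mult.commute add.commute)
qed

text \<open>At j = 0 this is the Taylor polynomial of exp (- x); general j is what the induction on
  the inner Horner levels needs.\<close>

lemma nexp_poly_eq_sum:
  "nexp_poly x (real j + 1) n = (\<Sum>k\<le>n. (- x) ^ k * fact j / fact (j + k))"
proof (induction n arbitrary: j)
  case (Suc n)
  have "(\<Sum>k\<le>Suc n. (- x) ^ k * fact j / fact (j + k)) = 1 + (\<Sum>k\<le>n. (- x) ^ Suc k * fact j / fact (j + Suc k))"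
    by (subst sum.atMost_Suc_shift) simp
  also have "(\<Sum>k\<le>n. (- x) ^ Suc k * fact j / fact (j + Suc k)) = - x / (real j + 1) * (\<Sum>k\<le>n. (- x) ^ k * fact (Suc j) / fact (Suc j + k))"
  proof -
    have "fact (Suc j) = (real j + 1) * fact j" by simp
    then show ?thesis
      unfolding sum_distrib_left by (intro sum.cong) (simp_all del: fact_Suc)
  qed
  also have "\<dots> = - x / (real j + 1) * nexp_poly x (real (Suc j) + 1) n"
    by (simp only: Suc.IH)
  finally show ?case by (simp add: add_ac)
qed simp

fun nsquare :: "nat \<Rightarrow> int \<Rightarrow> int" where
  "nsquare 0 E = E"
| "nsquare (Suc n) E = nsquare n (fx_shift (E * E))"

text \<open>Squaring a number of [0, 1] turns the error e into 2 e + 1, so e + 1 doubles each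
  time.\<close>

lemma near_nsquare:
  assumes "near e E v" "0 \<le> E" "E \<le> fx_one" "0 \<le> v" "v \<le> 1"
  shows "near (2 ^ n * (e + 1) - 1) (nsquare n E) (v ^ (2 ^ n))"
  using assms
proof (induction n arbitrary: e E v)
  case (Suc n)
  have "near (1 * e + e + 1) (fx_shift (E * E)) (v * v)"
    using Suc.prems by (intro near_mult) auto
  moreover have "0 \<le> fx_shift (E * E)"
    using fx_one_pos by (simp add: fx_shift pos_imp_zdiv_nonneg_iff)
  moreover have "fx_shift (E * E) \<le> fx_one"
  proof -
    have "E * E \<le> fx_one * fx_one" using Suc.prems by (intro mult_mono) auto
    then show ?thesis using zdiv_mono1[OF _ fx_one_pos(1)] fx_one_pos unfolding fx_shift by fastforce
  qed
  ultimately have "near (2 ^ n * (1 * e + e + 1 + 1) - 1) (nsquare n (fx_shift (E * E))) ((v * v) ^ (2 ^ n))"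
    using Suc.prems by (intro Suc.IH) (auto simp: mult_le_one)
  then show ?case
    by (simp add: algebra_simps power_mult flip: power2_eq_square)
qed simp

text \<open>
  The argument is passed after division by 256, which is undone by eight squarings of the Taylor
  polynomial.
\<close>

definition nexp :: "int \<Rightarrow> int" where "nexp X = nsquare 8 (nexp_horner X 1 13)"

text \<open>The Horner scheme contributes 3 units and the Taylor remainder of order 14 at most 1.
  Eight squarings turn 4 into 256 * 5 - 1, which is below 1280.\<close>

lemma near_nexp:
  assumes "0 \<le> X" "256 * X \<le> fx_one"
  shows "near 1280 (nexp X) (exp (- (256 * of_int X / of_int fx_one)))"
proof -
  define x :: real where "x = of_int X / of_int fx_one"
  have x: "0 \<le> x" "x \<le> 1 / 256"
  proof -
    have "real_of_int (256 * X) \<le> of_int fx_one" using assms(2) of_int_le_iff by blast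
    then show "0 \<le> x" "x \<le> 1 / 256"
      using assms(1) fx_one_pos(2) by (simp_all add: x_def field_simps)
  qed
  have near3: "near 3 (nexp_horner X 1 13) (nexp_poly x 1 13)" "0 \<le> nexp_horner X 1 13"
     "nexp_horner X 1 13 \<le> fx_one"
    using near_nexp_horner[OF assms, of 1 13] by (simp_all add: x_def)
  obtain t where t: "\<bar>t\<bar> \<le> \<bar>- x\<bar>" "exp (- x) = (\<Sum>m<14. (- x) ^ m / fact m) + exp t / fact 14 * (- x) ^ 14"
    using Maclaurin_exp_le[of "- x" 14] by blast
  have poly: "nexp_poly x 1 13 = (\<Sum>m<14. (- x) ^ m / fact m)"
    using nexp_poly_eq_sum[of x 0 13] by (simp add: lessThan_Suc_atMost[symmetric])
  have "exp t \<le> exp 1" using t(1) x by simp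
  also have "exp 1 \<le> (3 :: real)" by (rule exp_le)
  finally have "exp t \<le> 3" .
  have "\<bar>exp t / fact 14 * (- x) ^ 14\<bar> = exp t / fact 14 * x ^ 14"
    using x by (simp add: abs_mult)
  also have "\<dots> \<le> 3 / fact 14 * (1 / 256) ^ 14"
    using x \<open>exp t \<le> 3\<close> by (intro mult_mono power_mono frac_le) auto
  also have "\<dots> * of_int fx_one \<le> (1::real)"
    by (simp add: fx_one_def fact_numeral power_divide)
  finally have "\<bar>exp t / fact 14 * (- x) ^ 14\<bar> * of_int fx_one \<le> 1"
    using fx_one_pos(2) by simp
  then have "\<bar>(exp (- x) - nexp_poly x 1 13) * of_int fx_one\<bar> \<le> 1"
    using fx_one_pos(2) unfolding poly t(2) by (simp add: abs_mult)
  then have "near 4 (nexp_horner X 1 13) (exp (- x))"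
    using near3(1) unfolding near_def by (simp add: algebra_simps)
  then have "near (2 ^ 8 * (4 + 1) - 1) (nsquare 8 (nexp_horner X 1 13)) (exp (- x) ^ (2 ^ 8))"
    using near3 x by (intro near_nsquare) auto
  moreover have "exp (- x) ^ (2 ^ 8) = exp (- (256 * of_int X / of_int fx_one))"
    by (simp add: x_def flip: exp_of_nat_mult)
  ultimately show ?thesis
    unfolding nexp_def by (auto elim: near_mono)
qed

text \<open>
  The state \<open>V\<close>, \<open>B\<close> at step \<open>k\<close> approximates \<open>u y\<^sup>k\<close> and \<open>(s)\<^sub>k/k!\<close>.
\<close>

fun pell_sum :: "int \<Rightarrow> int \<Rightarrow> int \<Rightarrow> nat \<Rightarrow> int \<Rightarrow> int \<Rightarrow> int" where
  "pell_sum S Y k 0 V B = 0"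
| "pell_sum S Y k (Suc n) V B =
     (if even k then fx_shift (B * (V * fx_one div (fx_one - V)))
      else - fx_shift (B * (V * fx_one div (fx_one + V)))) +
     pell_sum S Y (k + 1) n (fx_shift (V * Y)) (fx_shift (B * (S + k * fx_one)) div (k + 1))"

fun pell_sum_real :: "real \<Rightarrow> real \<Rightarrow> nat \<Rightarrow> nat \<Rightarrow> real \<Rightarrow> real \<Rightarrow> real" where
  "pell_sum_real s y k 0 v b = 0"
| "pell_sum_real s y k (Suc n) v b =
     b * ((-1) ^ k * v / (1 - (-1) ^ k * v)) +
     pell_sum_real s y (Suc k) n (v * y) (b * (s + real k) / real (Suc k))"

text \<open>On [0, 1/2] the maps v / (1 - v) and v / (1 + v) have Lipschitz constants 4 and 1; the
  difference quotient is written out exactly, and the division adds one unit.\<close>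

lemma near_frac:
  assumes V: "near e V v" "0 \<le> V" "2 * V \<le> fx_one" and v: "0 \<le> v" "v \<le> 1 / 2"
  shows "near (4 * e + 1) (V * fx_one div (fx_one - V)) (v / (1 - v))"
    and "near (4 * e + 1) (V * fx_one div (fx_one + V)) (v / (1 + v))"
proof -
  define D :: real where "D = of_int fx_one"
  have D: "D > 0" using fx_one_pos by (simp add: D_def)
  have V': "0 \<le> real_of_int V" "2 * real_of_int V \<le> D"
    using V(2,3) unfolding D_def by (simp, metis of_int_le_iff of_int_mult of_int_numeral)
  have e: "\<bar>of_int V - v * D\<bar> \<le> e" using V(1) by (simp add: near_def D_def)
  have "e \<ge> 0" using e by linarith
  have "real_of_int V * D / (D - real_of_int V) - v / (1 - v) * D
      = (of_int V - v * D) / ((1 - of_int V / D) * (1 - v))"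
    using D V' v by (simp add: divide_simps) (simp add: algebra_simps)
  also have "\<bar>\<dots>\<bar> \<le> e / (1/2 * (1/2))"
    unfolding abs_divide
  proof (rule frac_le)
    show "1 / 2 * (1 / 2) \<le> \<bar>(1 - of_int V / D) * (1 - v)\<bar>"
      unfolding abs_mult using D V' v by (intro mult_mono) (auto simp: field_simps)
  qed (use e \<open>e \<ge> 0\<close> in auto)
  finally have 1: "\<bar>real_of_int V * D / (D - real_of_int V) - v / (1 - v) * D\<bar> \<le> 4 * e" by simp
  have "real_of_int V * D / (D + real_of_int V) - v / (1 + v) * D
      = (of_int V - v * D) / ((1 + of_int V / D) * (1 + v))"
    using D V' v by (simp add: divide_simps) (simp add: algebra_simps)
  also have "\<bar>\<dots>\<bar> \<le> e / (1 * 1)"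
    unfolding abs_divide
  proof (rule frac_le)
    show "1 * 1 \<le> \<bar>(1 + of_int V / D) * (1 + v)\<bar>"
      unfolding abs_mult using D V' v by (intro mult_mono) (auto simp: field_simps)
  qed (use e \<open>e \<ge> 0\<close> in auto)
  finally have 2: "\<bar>real_of_int V * D / (D + real_of_int V) - v / (1 + v) * D\<bar> \<le> 4 * e" 
    using \<open>e \<ge> 0\<close> by simp
  have "fx_one - V > 0" "fx_one + V > 0" using V fx_one_pos by linarith+
  then show "near (4 * e + 1) (V * fx_one div (fx_one - V)) (v / (1 - v))"
    and "near (4 * e + 1) (V * fx_one div (fx_one + V)) (v / (1 + v))"
    using 1 2 by (auto intro!: near_int_div simp: D_def)
qed

text \<open>The error of \<open>V\<close> stays at \<open>E\<close>, since y \<le> 1/5 gives E/5 + 2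
  \<le> E once E \<ge> 3. The error of \<open>B\<close> grows by at most 3 per step, because the
  factor (s + k)/(k + 1) is at most 1. Each summand then costs its current error of \<open>B\<close>
  plus 4 E + 2.\<close>

lemma near_pell_sum:
  assumes y: "near 1 Y y" "0 \<le> y" "y \<le> 1 / 5" "0 \<le> Y" "Y \<le> fx_one"
    and s: "near 1 S s" "0 \<le> s" "s \<le> 1" "0 \<le> S" "S \<le> fx_one" and E: "E \<ge> 3"
    and V: "near E V v" "0 \<le> V" "2 * V \<le> fx_one" "0 \<le> v" "v \<le> 1 / 2"
    and B: "near e B b" "0 \<le> B" "B \<le> fx_one" "0 \<le> b" "b \<le> 1"
  shows "near (real n * (4 * E + e + 3 * real n + 2)) (pell_sum S Y (int k) n V B) (pell_sum_real s y k n v b)"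
  using V B
proof (induction n arbitrary: k V v B b e)
  case 0
  then show ?case by (simp add: near_def)
next
  case (Suc n)
  note V = Suc.prems(1-5) and B = Suc.prems(6-10)
  have D: "fx_one > 0" by (rule fx_one_pos)
  have e: "e \<ge> 0" using B(1) by (simp add: near_def)
  have v2: "near E (fx_shift (V * Y)) (v * y)"
    using near_mult[OF V(1) y(1) V(2) _ y(2,3)] V(3) D E by (auto elim: near_mono)
  have V2: "0 \<le> fx_shift (V * Y)" "2 * fx_shift (V * Y) \<le> fx_one"
  proof -
    show "0 \<le> fx_shift (V * Y)"
      using V y D by (simp add: fx_shift pos_imp_zdiv_nonneg_iff)
    have "V * Y \<le> V * fx_one" using V y by (intro mult_mono) auto
    then have "fx_shift (V * Y) \<le> V"
      using zdiv_mono1[OF _ D] D unfolding fx_shift by fastforce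
    then show "2 * fx_shift (V * Y) \<le> fx_one" using V by linarith
  qed
  have vy: "0 \<le> v * y" "v * y \<le> 1 / 2"
    using mult_mono[of v "1/2" y 1] V y by auto
  have sk: "near 1 (S + int k * fx_one) (s + real k)"
    using s(1) by (simp add: near_def algebra_simps)
  have "near ((s + real k) * e + 1 + 1) (fx_shift (B * (S + int k * fx_one))) (b * (s + real k))"
    using near_mult[OF B(1) sk B(2,3)] s by simp
  then have "near (((s + real k) * e + 1 + 1) / of_int (int k + 1) + 1)
     (fx_shift (B * (S + int k * fx_one)) div (int k + 1)) (b * (s + real k) / of_int (int k + 1))"
    by (rule near_div) simp
  moreover have "((s + real k) * e + 1 + 1) / of_int (int k + 1) + 1 \<le> e + 3"
  proof -
    have "(s + real k) * e \<le> (1 + real k) * e" using s e by (intro mult_right_mono) auto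
    then have "(s + real k) * e + 2 \<le> (e + 2) * (1 + real k)"
      by (simp add: algebra_simps)
    then show ?thesis by (simp add: field_simps)
  qed
  ultimately have b2: "near (e + 3) (fx_shift (B * (S + int k * fx_one)) div (int k + 1)) (b * (s + real k) / real (Suc k))"
    using near_mono by (fastforce simp: add.commute)
  have B2: "0 \<le> fx_shift (B * (S + int k * fx_one)) div (int k + 1)"
     "fx_shift (B * (S + int k * fx_one)) div (int k + 1) \<le> fx_one"
  proof -
    have "0 \<le> B * (S + int k * fx_one)" using B s D by simp
    then show "0 \<le> fx_shift (B * (S + int k * fx_one)) div (int k + 1)"
      using D by (simp add: fx_shift pos_imp_zdiv_nonneg_iff)
    have "B * (S + int k * fx_one) \<le> fx_one * (fx_one + int k * fx_one)"
      using B s D by (intro mult_mono) auto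
    also have "\<dots> = (fx_one * (int k + 1)) * fx_one" by (simp add: algebra_simps)
    finally have "fx_shift (B * (S + int k * fx_one)) \<le> fx_one * (int k + 1)"
      using zdiv_mono1[OF _ D] D unfolding fx_shift by fastforce
    then show "fx_shift (B * (S + int k * fx_one)) div (int k + 1) \<le> fx_one"
      using zdiv_mono1[of "fx_shift (B * (S + int k * fx_one))" "fx_one * (int k + 1)" "int k + 1"] by fastforce
  qed
  have bb: "0 \<le> b * (s + real k) / real (Suc k)" "b * (s + real k) / real (Suc k) \<le> 1"
  proof -
    show "0 \<le> b * (s + real k) / real (Suc k)" using B s by simp
    have "b * (s + real k) \<le> 1 * (1 + real k)" using B s by (intro mult_mono) auto
    then show "b * (s + real k) / real (Suc k) \<le> 1" by (simp add: field_simps)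
  qed
  have IH: "near (real n * (4 * E + (e + 3) + 3 * real n + 2))
      (pell_sum S Y (int (Suc k)) n (fx_shift (V * Y)) (fx_shift (B * (S + int k * fx_one)) div (int k + 1)))
      (pell_sum_real s y (Suc k) n (v * y) (b * (s + real k) / real (Suc k)))"
    by (rule Suc.IH[OF v2 V2 vy b2 B2 bb])
  have g: "0 \<le> v / (1 - v)" "v / (1 - v) \<le> 1" "0 \<le> v / (1 + v)" "v / (1 + v) \<le> 1"
    using V by (auto simp: field_simps)
  have t1: "near (e + (4 * E + 1) + 1) (fx_shift (B * (V * fx_one div (fx_one - V)))) (b * (v / (1 - v)))"
    using near_mult[OF B(1) near_frac(1)[OF V] B(2,3) g(1,2)] by simp
  have t2: "near (e + (4 * E + 1) + 1) (fx_shift (B * (V * fx_one div (fx_one + V)))) (b * (v / (1 + v)))"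
    using near_mult[OF B(1) near_frac(2)[OF V] B(2,3) g(3,4)] by simp
  have t: "near (e + (4 * E + 1) + 1) (if even (int k) then fx_shift (B * (V * fx_one div (fx_one - V)))
      else - fx_shift (B * (V * fx_one div (fx_one + V)))) (b * ((-1) ^ k * v / (1 - (-1) ^ k * v)))"
    using t1 t2 by (auto simp: near_def)
  have add: "near a X x \<Longrightarrow> near c Z z \<Longrightarrow> near (a + c) (X + Z) (x + z)" for a c x z X Z
    unfolding near_def by (simp add: algebra_simps)
  from add[OF t IH]
  have "near ((e + (4 * E + 1) + 1) + real n * (4 * E + (e + 3) + 3 * real n + 2)) (pell_sum S Y (int k) (Suc n) V B)
          (pell_sum_real s y k (Suc n) v b)"
    by (simp add: add.commute)
  then show ?case
    by (rule near_mono) (simp add: algebra_simps)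
qed

section \<open>Expansion by Binet's formula\<close>

lemma pell_binet: "2 * sqrt 2 * real (pell n) = (1 + sqrt 2) ^ n - (1 - sqrt 2) ^ n"
proof (induction n rule: pell.induct)
  case (3 n)
  have *: "x ^ Suc (Suc n) = 2 * x ^ Suc n + x ^ n" if "x\<^sup>2 = 2 * x + 1" for x :: real
  proof -
    have "x ^ Suc (Suc n) = x ^ n * x\<^sup>2" by (simp add: power2_eq_square)
    also have "\<dots> = 2 * x ^ Suc n + x ^ n" unfolding that by (simp add: algebra_simps)
    finally show ?thesis .
  qed
  have "(1 + sqrt 2)\<^sup>2 = 2 * (1 + sqrt 2) + (1::real)" "(1 - sqrt 2)\<^sup>2 = 2 * (1 - sqrt 2) + (1::real)"
    by (simp_all add: power2_eq_square algebra_simps)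
  note * = *[OF this(1)] *[OF this(2)]
  have "2 * sqrt 2 * real (pell (Suc (Suc n))) = 2 * (2 * sqrt 2 * real (pell (Suc n))) + 2 * sqrt 2 * real (pell n)"
    by (simp add: algebra_simps)
  also have "\<dots> = (1 + sqrt 2) ^ Suc (Suc n) - (1 - sqrt 2) ^ Suc (Suc n)"
    unfolding 3 * by (simp only: algebra_simps)
  finally show ?case .
qed simp_all

text \<open>Factoring out \<alpha>^n leaves the ratio of the two roots, (1 - sqrt 2)/(1 + sqrt 2) =
  - (3 - 2 sqrt 2), the small quantity in which the expansion is made.\<close>

lemma pell_binet':
  "real (pell n) = (1 + sqrt 2) ^ n * (1 - (- (3 - 2 * sqrt 2)) ^ n) / (2 * sqrt 2)"
proof -
  have "(1 + sqrt 2) * (- (3 - 2 * sqrt 2)) = (1 - sqrt 2 :: real)"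
    by (simp add: algebra_simps)
  then have "(1 + sqrt 2) ^ n * (- (3 - 2 * sqrt 2)) ^ n = (1 - sqrt 2 :: real) ^ n"
    by (metis power_mult_distrib)
  then have "(1 + sqrt 2) ^ n * (1 - (- (3 - 2 * sqrt 2)) ^ n) = 2 * sqrt 2 * real (pell n)"
    unfolding pell_binet by (simp only: right_diff_distrib mult_1_right)
  then show ?thesis by simp
qed

lemma sqrt2_bounds: "sqrt 2 < (1.4143 :: real)" "sqrt 2 > (1.4142 :: real)"
  by (rule real_less_lsqrt real_less_rsqrt; simp add: power2_eq_square)+

lemma pochhammer_over_fact_bounds:
  assumes "0 \<le> s" "s \<le> (1::real)"
  shows "0 \<le> pochhammer s k / fact k" "pochhammer s k / fact k \<le> 1"
proof -
  show "0 \<le> pochhammer s k / fact k"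
    using assms by (simp add: pochhammer_prod prod_nonneg)
  have "pochhammer s k \<le> fact k"
    unfolding pochhammer_fact pochhammer_prod using assms by (intro prod_mono) auto
  then show "pochhammer s k / fact k \<le> 1" by simp
qed

text \<open>For s in [0, 1] all binomial coefficients involved lie in [0, 1], so the tail is
  dominated by a geometric series.\<close>

lemma binomial_series_remainder:
  assumes "0 \<le> s" "s \<le> 1" "\<bar>x\<bar> < (1::real)"
  shows "\<bar>(1 - x) powr (- s) - (\<Sum>k<K. pochhammer s k / fact k * x ^ k)\<bar> \<le> \<bar>x\<bar> ^ K / (1 - \<bar>x\<bar>)"
proof -
  define b where "b k = pochhammer s k / fact k" for k
  have "(\<lambda>k. (- s gchoose k) * (- x) ^ k) sums (1 + (- x)) powr (- s)"
    using assms by (intro gen_binomial_real) auto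
  moreover have "(- s gchoose k) * (- x) ^ k = b k * x ^ k" for k
  proof -
    have "(- 1) ^ k * (- x) ^ k = x ^ k" by (simp flip: power_mult_distrib)
    then have "pochhammer s k / fact k * ((- 1) ^ k * (- x) ^ k) = b k * x ^ k" by (simp only: b_def)
    then show ?thesis by (simp only: gbinomial_pochhammer minus_minus) (simp only: mult_ac times_divide_eq_right times_divide_eq_left)
  qed
  ultimately have "(\<lambda>k. b k * x ^ k) sums (1 - x) powr (- s)" by simp
  then have "(\<lambda>k. b (k + K) * x ^ (k + K)) sums ((1 - x) powr (- s) - (\<Sum>k<K. b k * x ^ k))"
    by (subst sums_iff_shift) simp
  moreover have "(\<lambda>k. \<bar>x\<bar> ^ K * \<bar>x\<bar> ^ k) sums (\<bar>x\<bar> ^ K * (1 / (1 - \<bar>x\<bar>)))"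
    using assms by (intro sums_mult geometric_sums) auto
  moreover have "\<bar>b (k + K) * x ^ (k + K)\<bar> \<le> \<bar>x\<bar> ^ K * \<bar>x\<bar> ^ k" for k
  proof -
    have "\<bar>b (k + K)\<bar> \<le> 1"
      using pochhammer_over_fact_bounds[OF assms(1,2), of "k + K"] unfolding b_def by linarith
    from mult_right_mono[OF this, of "\<bar>x\<bar> ^ (k + K)"] show ?thesis
      by (simp add: abs_mult power_add power_abs mult_ac)
  qed
  ultimately show ?thesis
    using norm_sums_le[of "\<lambda>k. b (k + K) * x ^ (k + K)" _ "\<lambda>k. \<bar>x\<bar> ^ K * \<bar>x\<bar> ^ k"]
    unfolding b_def real_norm_def by fastforce
qed

definition Z_real :: "real \<Rightarrow> real" where
  "Z_real s = (\<Sum>n. real (pell (Suc n)) powr (- s))"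

lemma pell_pos: "n > 0 \<Longrightarrow> pell n > 0"
  using pell_ge_two_power[of "n - 1"] by (cases n) (auto intro: Nat.gr0I)

lemma summable_Z_real:
  assumes "s > 0"
  shows "summable (\<lambda>n. real (pell (Suc n)) powr (- s))"
proof -
  have "norm (of_nat (pell (Suc n)) powr (- complex_of_real s)) = real (pell (Suc n)) powr (- s)" for n
    by (subst norm_powr_real_powr) auto
  then show ?thesis using summable_pell[of "of_real s"] assms by simp
qed

lemma Z_Pell_of_real:
  assumes "s > 0"
  shows "Z_Pell (of_real s) = of_real (Z_real s)"
proof -
  have "of_nat (pell (Suc n)) powr (- complex_of_real s) = of_real (real (pell (Suc n)) powr (- s))" for n
    by (subst powr_of_real [symmetric]) auto
  then show ?thesis
    unfolding Z_Pell_def Z_real_def using suminf_of_real[OF summable_Z_real[OF assms], where ?'a = complex] by simp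
qed

text \<open>Every term is expanded to the same order \<open>K\<close>, so the finite sum over k can
  be exchanged with the sum over the index m. Each k then yields a geometric series of ratio u
  (-y)^k, and the remainders add up to one of ratio u y^K.\<close>

lemma Z_real_approx:
  fixes s :: real
  defines "y \<equiv> 3 - 2 * sqrt 2"
  defines "u \<equiv> (1 + sqrt 2) powr (- s)" and "C \<equiv> (2 * sqrt 2) powr s"
  assumes s: "0 < s" "s \<le> 1"
  shows "\<bar>Z_real s - C * (\<Sum>k<K. pochhammer s k / fact k * (u * (- y) ^ k / (1 - u * (- y) ^ k)))\<bar>
         \<le> C / (1 - y) * (u * y ^ K / (1 - u * y ^ K))"
proof -
  define b where "b k = pochhammer s k / fact k" for k
  have y: "0 < y" "y < 1" using sqrt2_bounds by (auto simp: y_def)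
  have u: "0 < u" "u < 1"
    using s sqrt2_bounds by (auto simp: u_def intro!: powr_less_one)
  have C: "C > 0" using sqrt2_bounds by (simp add: C_def)
  have uy: "\<bar>u * (- y) ^ k\<bar> < 1" "0 \<le> u * y ^ k" "u * y ^ k < 1" for k
  proof -
    have "u * y ^ k \<le> u * 1" using u y by (intro mult_left_mono power_le_one) auto
    then have "u * y ^ k < 1" using u by linarith
    then show "\<bar>u * (- y) ^ k\<bar> < 1" "0 \<le> u * y ^ k" "u * y ^ k < 1" using u y by (auto simp: abs_mult power_abs)
  qed
  have pell_powr: "real (pell m) powr (- s) = C * (u ^ m * (1 - (- y) ^ m) powr (- s))" if "m > 0" for m
  proof -
    have "\<bar>(- y) ^ m\<bar> \<le> \<bar>- y\<bar> ^ 1"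
      unfolding power_abs using y that by (intro power_decreasing) auto
    then have "(- y) ^ m \<le> \<bar>- y\<bar> ^ 1" by (rule order.trans[OF abs_ge_self])
    then have "(- y) ^ m < 1" using y by simp
    have "real (pell m) = (1 + sqrt 2) ^ m * (1 - (- y) ^ m) / (2 * sqrt 2)"
      unfolding y_def by (rule pell_binet')
    also have "\<dots> powr (- s) = ((1 + sqrt 2) ^ m) powr (- s) * (1 - (- y) ^ m) powr (- s) / (2 * sqrt 2) powr (- s)"
      using \<open>(- y) ^ m < 1\<close> sqrt2_bounds by (subst powr_divide powr_mult; simp)+
    also have "((1 + sqrt 2) ^ m) powr (- s) = u ^ m"
      using sqrt2_bounds unfolding u_def by (simp add: powr_powr mult.commute flip: powr_realpow)
    finally show ?thesis by (simp add: C_def powr_minus field_simps)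
  qed
  have geo: "(\<lambda>n. w ^ Suc n) sums (w / (1 - w))" if "\<bar>w\<bar> < 1" for w :: real
    using sums_mult[OF geometric_sums[of w], of w] that by simp
  have "(\<lambda>n. C * (\<Sum>k<K. b k * (u * (- y) ^ k) ^ Suc n)) sums
        (C * (\<Sum>k<K. b k * (u * (- y) ^ k / (1 - u * (- y) ^ k))))"
    by (intro sums_mult sums_sum geo uy)
  moreover have "(\<lambda>n. real (pell (Suc n)) powr (- s)) sums Z_real s"
    unfolding Z_real_def using summable_Z_real[OF s(1)] by (rule summable_sums)
  ultimately have diff: "(\<lambda>n. real (pell (Suc n)) powr (- s) - C * (\<Sum>k<K. b k * (u * (- y) ^ k) ^ Suc n)) sums
     (Z_real s - C * (\<Sum>k<K. b k * (u * (- y) ^ k / (1 - u * (- y) ^ k))))"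
    using sums_diff by blast
  have bound: "(\<lambda>n. C / (1 - y) * (u * y ^ K) ^ Suc n) sums (C / (1 - y) * (u * y ^ K / (1 - u * y ^ K)))"
    using uy by (intro sums_mult geo) auto
  have "\<bar>real (pell m) powr (- s) - C * (\<Sum>k<K. b k * (u * (- y) ^ k) ^ m)\<bar>
      \<le> C / (1 - y) * (u * y ^ K) ^ m" if "m > 0" for m
  proof -
    have ym: "\<bar>(- y) ^ m\<bar> = y ^ m" "y ^ m \<le> y" 
      using y that power_decreasing[of 1 m y] by (auto simp: power_abs)
    have "(\<Sum>k<K. b k * (u * (- y) ^ k) ^ m) = u ^ m * (\<Sum>k<K. b k * ((- y) ^ m) ^ k)"
      unfolding sum_distrib_left
      by (intro sum.cong) (simp_all add: power_mult_distrib mult_ac flip: power_mult)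
    then have "real (pell m) powr (- s) - C * (\<Sum>k<K. b k * (u * (- y) ^ k) ^ m)
       = C * u ^ m * ((1 - (- y) ^ m) powr (- s) - (\<Sum>k<K. b k * ((- y) ^ m) ^ k))"
      using pell_powr[OF that] by (simp add: algebra_simps)
    also have "\<bar>\<dots>\<bar> = C * u ^ m * \<bar>(1 - (- y) ^ m) powr (- s) - (\<Sum>k<K. b k * ((- y) ^ m) ^ k)\<bar>"
      using C u by (simp add: abs_mult)
    also have "\<dots> \<le> C * u ^ m * (\<bar>(- y) ^ m\<bar> ^ K / (1 - \<bar>(- y) ^ m\<bar>))"
      unfolding b_def using C u s ym y by (intro mult_left_mono binomial_series_remainder) auto
    also have "\<dots> = C * u ^ m * ((y ^ m) ^ K / (1 - y ^ m))" by (simp only: ym)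
    also have "\<dots> \<le> C * u ^ m * ((y ^ m) ^ K / (1 - y))"
      using C u y ym by (intro mult_left_mono divide_left_mono) auto
    also have "\<dots> = C / (1 - y) * (u * y ^ K) ^ m"
      by (simp add: power_mult_distrib mult_ac flip: power_mult)
    finally show ?thesis .
  qed
  then show ?thesis
    using norm_sums_le[OF diff bound] unfolding real_norm_def b_def by blast
qed

text \<open>The recursion keeps the sign (-1)^k apart from u y^k, so that the fixed-point state
  remains nonnegative.\<close>

lemma pell_sum_real_eq_sum:
  "pell_sum_real s y k n (u * y ^ k) (pochhammer s k / fact k) =
     (\<Sum>i<n. pochhammer s (k + i) / fact (k + i) * (u * (- y) ^ (k + i) / (1 - u * (- y) ^ (k + i))))"
proof (induction n arbitrary: k)
  case (Suc n)
  have "pochhammer s k / fact k * (s + real k) / real (Suc k) = pochhammer s (Suc k) / fact (Suc k)"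
    by (simp add: pochhammer_Suc)
  moreover have "u * y ^ k * y = u * y ^ Suc k" by simp
  moreover have "(-1) ^ k * (u * y ^ k) = u * (- y) ^ k" by (subst power_minus) simp
  ultimately show ?case
    unfolding pell_sum_real.simps sum.lessThan_Suc_shift
    using Suc.IH[of "Suc k"] by (simp only: mult.assoc [symmetric] add_Suc_shift add_0_right)
qed simp

section \<open>Certified constants and logarithms\<close>

lemma exp_neg_lipschitz:
  assumes "0 \<le> x" "0 \<le> y"
  shows "\<bar>exp (- x) - exp (- y)\<bar> \<le> \<bar>x - y :: real\<bar>"
proof -
  have *: "exp (- x) - exp (- y) \<le> y - x" "0 \<le> exp (- x) - exp (- y)" if "0 \<le> x" "x \<le> y" for x y :: real
  proof -
    have "exp (- x) - exp (- y) = exp (- x) * (1 - exp (- (y - x)))"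
      by (simp add: algebra_simps flip: exp_add)
    also have "\<dots> \<le> 1 * (y - x)"
    proof (intro mult_mono)
      show "1 - exp (- (y - x)) \<le> y - x" using exp_ge_add_one_self[of "- (y - x)"] by linarith
    qed (use that in auto)
    finally show "exp (- x) - exp (- y) \<le> y - x" by simp
  qed (use that in auto)
  show ?thesis
    using *[of x y] *[of y x] assms by (cases "x \<le> y") auto
qed

lemma ln_diff_bound:
  assumes "m > 0" "m \<le> p" "m \<le> q"
  shows "\<bar>ln p - ln q\<bar> \<le> \<bar>p - q\<bar> / (m::real)"
proof -
  have *: "ln p - ln q \<le> \<bar>p - q\<bar> / m" if "m \<le> p" "m \<le> q" for p q
  proof -
    have "ln p - ln q \<le> (p - q) / q" using assms(1) that by (intro ln_diff_le) auto
    also have "\<dots> \<le> \<bar>p - q\<bar> / m" using assms(1) that by (intro frac_le) auto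
    finally show ?thesis .
  qed
  show ?thesis using *[of p q] *[of q p] assms by (auto simp: abs_if)
qed

definition fx_y :: int where "fx_y = 58383224090797344209988732384804406659"

lemma near_fx_y: "near 1 fx_y (3 - 2 * sqrt 2)"
proof -
  define D Y :: real where "D = of_int fx_one" and "Y = of_int fx_y"
  have D: "D > 0" using fx_one_pos by (simp add: D_def)
  have "(3 * D - Y - 1) / (2 * D) \<le> sqrt 2"
    by (rule real_le_rsqrt) (simp add: D_def Y_def fx_one_def fx_y_def power_divide)
  moreover have "sqrt 2 \<le> (3 * D - Y + 1) / (2 * D)"
    by (rule real_le_lsqrt) (simp_all add: D_def Y_def fx_one_def fx_y_def power_divide)
  ultimately show ?thesis
    using D unfolding near_def D_def[symmetric] Y_def[symmetric] by (simp add: field_simps abs_le_iff)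
qed

text \<open>
  The logarithms of 2 and of \<open>1 + \<surd>2\<close>, divided by 256 and rounded down; they are verified by
  exponentiating.
\<close>

definition fx_ln2 :: int where "fx_ln2 = 921350637599661305226344307672478454"
definition fx_lna :: int where "fx_lna = 1171546446611749319655979867046039946"

lemma nexp_ln2: "nexp fx_ln2 = 170141183460469231731687303715884105815"
  by code_simp

lemma nexp_lna: "nexp fx_lna = 140949571415070559626692937523481902433"
  by code_simp

text \<open>A proposed logarithm is checked through its exponential: ln has Lipschitz constant 1/0.4
  above 0.4, and (1280 + 100)/0.4 \<le> 3500. The bound 0.41 admits both values needed, 1/2 and sqrt
  2 - 1.\<close>

lemma ln_of_near_nexp:
  fixes q :: real
  assumes "0 \<le> X" "256 * X \<le> fx_one" "\<bar>of_int (nexp X) - q * of_int fx_one\<bar> \<le> 100" "0.41 \<le> q"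
  shows "\<bar>256 * of_int X - (- ln q) * of_int fx_one\<bar> \<le> 3500"
proof -
  define D :: real where "D = of_int fx_one"
  define p where "p = exp (- (256 * of_int X / D))"
  have D: "D > 10 ^ 30" by (simp add: D_def fx_one_def)
  have "\<bar>of_int (nexp X) - p * D\<bar> \<le> 1280"
    using near_nexp[OF assms(1,2)] by (simp add: near_def p_def D_def)
  then have "\<bar>p * D - q * D\<bar> \<le> 1380" using assms(3) unfolding D_def by linarith
  moreover have "p * D - q * D = (p - q) * D" by (simp add: algebra_simps)
  ultimately have pq: "\<bar>p - q\<bar> * D \<le> 1380" using D by (simp add: abs_mult)
  then have "\<bar>p - q\<bar> \<le> 1380 / D" using D by (simp add: field_simps)
  also have "\<dots> \<le> 1380 / 10 ^ 30" using D by (intro divide_left_mono) auto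
  also have "\<dots> \<le> 0.01" by simp
  finally have "p \<ge> 0.4" using assms(4) unfolding abs_le_iff by simp
  then have "\<bar>ln p - ln q\<bar> \<le> \<bar>p - q\<bar> / 0.4" using assms by (intro ln_diff_bound) auto
  then have "\<bar>ln p - ln q\<bar> * D \<le> \<bar>p - q\<bar> / 0.4 * D" using D by (intro mult_right_mono) auto
  also have "\<dots> = (\<bar>p - q\<bar> * D) / 0.4" by simp
  also have "\<dots> \<le> 1380 / 0.4" by (rule divide_right_mono[OF pq]) simp
  also have "\<dots> \<le> 3500" by simp
  finally have "\<bar>(ln p - ln q) * D\<bar> \<le> 3500" using D by (simp add: abs_mult)
  moreover have "(ln p - ln q) * D = - (256 * of_int X - (- ln q) * D)"
    using D by (simp add: p_def field_simps)
  ultimately show ?thesis unfolding D_def by linarith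
qed

lemma fx_ln2: "\<bar>256 * of_int fx_ln2 - ln 2 * of_int fx_one\<bar> \<le> (3500 :: real)"
proof -
  have "\<bar>256 * of_int fx_ln2 - (- ln (1 / 2)) * of_int fx_one\<bar> \<le> (3500 :: real)"
    by (intro ln_of_near_nexp) (simp_all add: nexp_ln2, simp_all add: fx_ln2_def fx_one_def)
  then show ?thesis by (simp add: ln_div)
qed

lemma fx_lna: "\<bar>256 * of_int fx_lna - ln (1 + sqrt 2) * of_int fx_one\<bar> \<le> (3500 :: real)"
proof -
  have "\<bar>of_int (nexp fx_lna) - (sqrt 2 - 1) * of_int fx_one\<bar> \<le> (100::real)"
  proof -
    define z w where "z = (3 - 2 * sqrt 2) * real_of_int fx_one" and "w = (sqrt 2 - 1) * real_of_int fx_one"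
    \<comment> \<open>As sqrt 2 - 1 = (1 - y)/2 for y = 3 - 2 sqrt 2, the verified
      \<open>fx_y\<close> also controls this number.\<close>
    have "w = (of_int fx_one - z) / 2"
      by (simp add: z_def w_def field_simps)
    moreover have "\<bar>of_int (nexp fx_lna) - (of_int fx_one - of_int fx_y :: real) / 2\<bar> \<le> 90"
      unfolding nexp_lna by (simp add: fx_one_def fx_y_def)
    ultimately show ?thesis using near_fx_y
      unfolding near_def z_def[symmetric] w_def[symmetric] by (simp add: field_simps)
  qed
  then have "\<bar>256 * of_int fx_lna - (- ln (sqrt 2 - 1)) * of_int fx_one\<bar> \<le> (3500 :: real)"
    using sqrt2_bounds by (intro ln_of_near_nexp) (simp_all add: fx_lna_def fx_one_def)
  moreover have "sqrt 2 - 1 = 1 / (1 + sqrt 2)"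
    using sqrt2_bounds by (simp add: field_simps)
  then have "ln (sqrt 2 - 1) = - ln (1 + sqrt 2)"
    using sqrt2_bounds by (simp add: ln_div)
  ultimately show ?thesis by simp
qed

lemma near_nexp_approx:
  assumes "0 \<le> X" "256 * X \<le> fx_one" "0 \<le> t" "\<bar>256 * of_int X - t * of_int fx_one\<bar> \<le> d"
  shows "near (1280 + d) (nexp X) (exp (- t))"
proof -
  define D :: real where "D = of_int fx_one"
  define x where "x = 256 * of_int X / D"
  have D: "D > 0" using fx_one_pos by (simp add: D_def)
  have "\<bar>of_int (nexp X) - exp (- x) * D\<bar> \<le> 1280"
    using near_nexp[OF assms(1,2)] by (simp add: near_def x_def D_def)
  moreover have "\<bar>exp (- x) - exp (- t)\<bar> * D \<le> \<bar>x - t\<bar> * D"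
    using D assms by (intro mult_right_mono exp_neg_lipschitz) (auto simp: x_def)
  moreover have "\<bar>x - t\<bar> * D = \<bar>256 * of_int X - t * D\<bar>"
  proof -
    have "\<bar>x - t\<bar> * D = \<bar>(x - t) * D\<bar>" using D by (simp add: abs_mult)
    also have "(x - t) * D = 256 * of_int X - t * D" using D by (simp add: x_def field_simps)
    finally show ?thesis .
  qed
  moreover have "\<bar>exp (- x) - exp (- t)\<bar> * D = \<bar>exp (- x) * D - exp (- t) * D\<bar>"
    using D by (simp add: abs_mult flip: left_diff_distrib)
  ultimately show ?thesis using assms(4) unfolding near_def D_def by linarith
qed

section \<open>Values at the two decimal endpoints\<close>

text \<open>Multiplying by k = (2 sqrt 2)^(-s) turns Z > 2 into R > 2 k, which avoids a division.
  The tolerance 10^7 covers about 10^6 units of rounding in the sum, 5 * 10^6 of truncation and 2 *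
  7000 from \<open>c\<close>. The two exponents carry 256 units from rounding \<open>XU\<close> and
  \<open>XC\<close>, besides the errors of the logarithms. The check on \<open>U\<close> ensures u
  \<le> 1/2.\<close>

lemma Z_real_certificate:
  fixes s :: real and S XU XC :: int
  defines "U \<equiv> nexp XU" and "c \<equiv> nexp XC"
  defines "T \<equiv> pell_sum S fx_y 0 42 U fx_one"
  assumes s: "0 < s" "s \<le> 1"
    and S: "near 1 S s" "0 \<le> S" "S \<le> fx_one"
    and XU: "0 \<le> XU" "256 * XU \<le> fx_one" "\<bar>of_int XU - s * of_int fx_lna\<bar> \<le> 1"
    and XC: "0 \<le> XC" "256 * XC \<le> fx_one" "\<bar>of_int XC - 3 / 2 * s * of_int fx_ln2\<bar> \<le> 1"
    and U: "0 \<le> U" "2 * (U + 6000) \<le> fx_one"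
  shows "T \<ge> 2 * c + 10000000 \<Longrightarrow> Z_real s > 2" "T \<le> 2 * c - 10000000 \<Longrightarrow> Z_real s < 2"
proof -
  define D :: real where "D = of_int fx_one"
  define y u k where "y = 3 - 2 * sqrt 2" and "u = (1 + sqrt 2) powr (- s)" and "k = (2 * sqrt 2) powr (- s)"
  have D: "D > 0" using fx_one_pos by (simp add: D_def)
  have y: "0 < y" "y \<le> 0.1716" using sqrt2_bounds by (simp_all add: y_def)
  have sqrt2: "1 + sqrt 2 > 1" using sqrt2_bounds by simp
  have k: "k > 0" "(2 * sqrt 2) powr s = 1 / k" by (simp_all add: k_def powr_minus field_simps)
  have u: "near 6000 U u"
  proof -
    have "0 \<le> s * ln (1 + sqrt 2)" using s sqrt2 by simp
    moreover have "\<bar>256 * of_int XU - s * ln (1 + sqrt 2) * of_int fx_one\<bar> \<le> 3756"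
    proof -
      have "\<bar>s * (256 * of_int fx_lna - ln (1 + sqrt 2) * of_int fx_one)\<bar> \<le> 1 * 3500"
        unfolding abs_mult using fx_lna s by (intro mult_mono) auto
      then show ?thesis using XU(3) by (simp add: algebra_simps)
    qed
    ultimately have "near (1280 + 3756) (nexp XU) (exp (- (s * ln (1 + sqrt 2))))"
      by (intro near_nexp_approx XU)
    moreover have "1 + sqrt 2 \<noteq> 0" using sqrt2 by linarith
    then have "exp (- (s * ln (1 + sqrt 2))) = u" by (simp add: u_def powr_def)
    ultimately show ?thesis unfolding U_def by (auto elim: near_mono)
  qed
  have c: "near 7000 c k"
  proof -
    have ln: "ln (2 * sqrt 2) = 3 / 2 * ln 2" by (simp add: ln_mult ln_sqrt)
    have "0 \<le> 3 / 2 * s * ln 2" using s by simp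
    moreover have "\<bar>256 * of_int XC - 3 / 2 * s * ln 2 * of_int fx_one\<bar> \<le> 5600"
    proof -
      have "\<bar>3 / 2 * s * (256 * of_int fx_ln2 - ln 2 * of_int fx_one)\<bar> \<le> 3 / 2 * 3500"
        unfolding abs_mult using fx_ln2 s by (intro mult_mono) auto
      then show ?thesis using XC(3) by (simp add: algebra_simps)
    qed
    ultimately have "near (1280 + 5600) (nexp XC) (exp (- (3 / 2 * s * ln 2)))"
      by (intro near_nexp_approx XC)
    moreover have "exp (- (3 / 2 * s * ln 2)) = k" using ln by (simp add: k_def powr_def algebra_simps)
    ultimately show ?thesis unfolding c_def by (auto elim: near_mono)
  qed
  have u': "0 < u" "u \<le> 1 / 2"
  proof -
    have "1 + sqrt 2 \<noteq> 0" using sqrt2 by linarith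
    then show "0 < u" by (simp add: u_def)
    have "2 * (real_of_int U + 6000) \<le> D"
      using U(2) unfolding D_def by (metis (mono_tags) of_int_add of_int_le_iff of_int_mult of_int_numeral)
    then have "u * D \<le> 1 / 2 * D"
      using u unfolding near_def D_def[symmetric] by (simp add: abs_le_iff field_simps)
    then show "u \<le> 1 / 2" using D by simp
  qed
  define R where "R = (\<Sum>i<42. pochhammer s i / fact i * (u * (- y) ^ i / (1 - u * (- y) ^ i)))"
  have R: "pell_sum_real s y 0 42 u 1 = R"
    using pell_sum_real_eq_sum[of s y 0 42 u] by (simp add: R_def)
  \<comment> \<open>The error bound evaluates to 42 * 24128 = 1013376.\<close>
  have "near (real 42 * (4 * 6000 + 0 + 3 * real 42 + 2)) (pell_sum S fx_y (int 0) 42 U fx_one) (pell_sum_real s y 0 42 u 1)"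
  proof (rule near_pell_sum)
    show "near 1 fx_y y" unfolding y_def by (rule near_fx_y)
    show "near 0 fx_one 1" by (simp add: near_def)
  qed (use y s S u U u' fx_one_pos in \<open>auto simp: fx_y_def fx_one_def\<close>)
  then have T: "\<bar>of_int T - R * D\<bar> \<le> 1013376"
    unfolding T_def R near_def D_def by simp
  have "\<bar>Z_real s - 1 / k * R\<bar> \<le> 1 / k / (1 - y) * (u * y ^ 42 / (1 - u * y ^ 42))"
    using Z_real_approx[OF s, of 42] k(2) by (simp add: R_def y_def u_def)
  also have "\<dots> \<le> 1 / k * (2 * y ^ 42)"
  proof -
    have "y ^ 42 \<le> y ^ 1" using y by (intro power_decreasing) auto
    then have "u * y ^ 42 \<le> 1 / 2 * 0.1716" using y u' by (intro mult_mono) auto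
    then have "u * y ^ 42 / (1 - u * y ^ 42) \<le> u * y ^ 42 / (1 / 2)"
      using y u' by (intro divide_left_mono) auto
    also have "\<dots> \<le> y ^ 42" using mult_right_mono[OF u'(2), of "y ^ 42"] y by simp
    finally have "1 / (1 - y) * (u * y ^ 42 / (1 - u * y ^ 42)) \<le> 2 * y ^ 42"
      using y u' \<open>u * y ^ 42 \<le> 1 / 2 * 0.1716\<close> by (intro mult_mono) (auto simp: field_simps)
    then have "1 / k * (1 / (1 - y) * (u * y ^ 42 / (1 - u * y ^ 42))) \<le> 1 / k * (2 * y ^ 42)"
      using k by (intro mult_left_mono) auto
    then show ?thesis by simp
  qed
  finally have "\<bar>Z_real s - 1 / k * R\<bar> * (k * D) \<le> 1 / k * (2 * y ^ 42) * (k * D)"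
    using k D by (intro mult_right_mono) auto
  also have "\<dots> = 2 * y ^ 42 * D" using k by simp
  \<comment> \<open>This is where the number 42 of terms is decided: 0.1716^42 is below 10^(-32),
    hence at most half the tolerance after scaling.\<close>
  also have "\<dots> \<le> 2 * 0.1716 ^ 42 * D"
    using y D by (intro mult_right_mono mult_left_mono power_mono) auto
  also have "\<dots> \<le> 5000000"
    by (simp add: D_def fx_one_def power_divide)
  also have "\<bar>Z_real s - 1 / k * R\<bar> * (k * D) = \<bar>(Z_real s - 1 / k * R) * (k * D)\<bar>"
    using k D by (simp add: abs_mult)
  also have "(Z_real s - 1 / k * R) * (k * D) = Z_real s * k * D - R * D"
    using k D by (simp add: field_simps)
  finally have Z: "\<bar>Z_real s * k * D - R * D\<bar> \<le> 5000000" .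
  have ck: "\<bar>of_int c - k * D\<bar> \<le> 7000" using c by (simp add: near_def D_def)
  {
    assume "T \<ge> 2 * c + 10000000"
    then have "real_of_int T \<ge> of_int (2 * c + 10000000)" by (simp only: of_int_le_iff)
    then have "Z_real s * k * D > 2 * (k * D)" using Z ck T by (simp add: abs_le_iff)
    then show "Z_real s > 2" using k D by simp
  next
    assume "T \<le> 2 * c - 10000000"
    then have "real_of_int T \<le> of_int (2 * c - 10000000)" by (simp only: of_int_le_iff)
    then have "Z_real s * k * D < 2 * (k * D)" using Z ck T by (simp add: abs_le_iff)
    then show "Z_real s < 2" using k D by simp
  }
qed

text \<open>The gap between \<open>T\<close> and \<open>2 * c\<close> is about 9.8 * 10^7 units here
  and about 10.1 * 10^7 at the upper endpoint, against a tolerance of 10^7. The three integers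
  passed to the certificate stand for s, s ln (1 + sqrt 2) / 256 and s ln (2 sqrt 2) / 256.\<close>

lemma Z_real_at_lower: "Z_real 0.875850904477574106444461159947 > 2"
proof -
  have U: "nexp 1026100014902388626040864738581730919 = 157247958111486160026122232179891968027"
    by code_simp
  have c: "nexp 1210448683923979427625009590012868593 = 136884210049936445967666291419575104983"
    by code_simp
  have T: "pell_sum 298036618845473697073841075690485070522 fx_y 0 42 157247958111486160026122232179891968027 fx_one = 273768420099872891935332582839247822915"
    by code_simp
  show ?thesis
    by (rule Z_real_certificate(1)[of _ 298036618845473697073841075690485070522 1026100014902388626040864738581730919 1210448683923979427625009590012868593])
       (simp_all add: U c T, simp_all add: near_def fx_one_def fx_lna_def fx_ln2_def)
qed

lemma Z_real_at_upper: "Z_real 0.875850904477574106444461159948 < 2"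
proof -
  have U: "nexp 1026100014902388626040864738582902465 = 157247958111486160026122232179753373914"
    by code_simp
  have c: "nexp 1210448683923979427625009590014250619 = 136884210049936445967666291419432783707"
    by code_simp
  have T: "pell_sum 298036618845473697073841075690825352889 fx_y 0 42 157247958111486160026122232179753373914 fx_one = 273768420099872891935332582838764100295"
    by code_simp
  show ?thesis
    by (rule Z_real_certificate(2)[of _ 298036618845473697073841075690825352889 1026100014902388626040864738582902465 1210448683923979427625009590014250619])
       (simp_all add: U c T, simp_all add: near_def fx_one_def fx_lna_def fx_ln2_def)
qed

section \<open>Primitive prime divisors\<close>

lemma pell_add: "pell (Suc (m + n)) = pell (Suc m) * pell (Suc n) + pell m * pell n"
proof (induction m rule: pell.induct)
  case (3 m)
  have "pell (Suc (Suc (Suc m) + n)) = 2 * pell (Suc (Suc m + n)) + pell (Suc (m + n))" by simp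
  also have "\<dots> = pell (Suc (Suc (Suc m))) * pell (Suc n) + pell (Suc (Suc m)) * pell n"
    unfolding 3 by (simp add: algebra_simps)
  finally show ?case .
qed simp_all

lemma coprime_pell_Suc: "coprime (pell n) (pell (Suc n))"
proof (induction n)
  case (Suc n)
  have "gcd (pell (Suc n)) (pell (Suc (Suc n))) = gcd (pell (Suc n)) (pell n)"
    by (simp add: gcd_add_mult[of "pell (Suc n)" 2 "pell n"])
  with Suc show ?case by (simp add: coprime_iff_gcd_eq_1 gcd.commute)
qed simp

text \<open>Modulo p the addition formula reduces to P_(m+n) = P_(m-1) P_n, and P_(m-1) is
  invertible because neighbouring Pell numbers are coprime.\<close>

lemma prime_dvd_pell_add:
  assumes "prime p" "m > 0" "p dvd pell m"
  shows "p dvd pell (m + n) \<longleftrightarrow> p dvd pell n"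
proof -
  obtain k where k: "m = Suc k" using assms(2) by (cases m) auto
  have "\<not> p dvd pell k"
    using assms coprime_pell_Suc[of k] unfolding k by (meson coprime_common_divisor not_prime_unit)
  moreover have "pell (m + n) = pell m * pell (Suc n) + pell k * pell n"
    unfolding k using pell_add[of k n] by simp
  ultimately show ?thesis
    using assms by (simp add: dvd_add_right_iff prime_dvd_mult_iff)
qed

text \<open>The rank of apparition of p. The lemmas about it carry a positive index n with p
  dividing P_n, which makes the \<open>LEAST\<close> meaningful.\<close>

definition pell_rank :: "nat \<Rightarrow> nat" where
  "pell_rank p = (LEAST r. r > 0 \<and> p dvd pell r)"

lemma pell_rank:
  assumes "n > 0" "p dvd pell n"
  shows "pell_rank p > 0" "p dvd pell (pell_rank p)" "pell_rank p \<le> n"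
  using LeastI[of "\<lambda>r. r > 0 \<and> p dvd pell r" n] Least_le[of "\<lambda>r. r > 0 \<and> p dvd pell r" n] assms
  by (auto simp: pell_rank_def)

text \<open>Subtracting the rank from the index preserves both sides; below the rank only index 0
  satisfies either.\<close>

lemma prime_dvd_pell_iff:
  assumes "prime p" "m > 0" "p dvd pell m"
  shows "p dvd pell n \<longleftrightarrow> pell_rank p dvd n"
proof (induction n rule: less_induct)
  case (less n)
  note r = pell_rank[OF assms(2,3)]
  show ?case
  proof (cases "n < pell_rank p")
    case True
    then have "p dvd pell n \<Longrightarrow> n = 0" using pell_rank(3)[of n p] by (cases "n = 0") auto
    with True show ?thesis using dvd_imp_le[of "pell_rank p" n] by auto
  next
    case False
    then obtain k where k: "n = pell_rank p + k" using le_Suc_ex not_less by blast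
    have "p dvd pell n \<longleftrightarrow> p dvd pell k"
      unfolding k using assms(1) r by (intro prime_dvd_pell_add) auto
    also have "\<dots> \<longleftrightarrow> pell_rank p dvd k" using r k by (intro less.IH) auto
    also have "\<dots> \<longleftrightarrow> pell_rank p dvd n" unfolding k by simp
    finally show ?thesis .
  qed
qed

text \<open>
  Both roots of \<open>x\<^sup>2 = 2 x + 1\<close> satisfy \<open>x\<^sup>m = P\<^sub>m x + P\<^sub>m\<^sub>-\<^sub>1\<close>; raise this to the power \<open>k\<close>.
\<close>

lemma pell_mult_eq_sum:
  "pell (Suc m * k) = (\<Sum>j\<le>k. (k choose j) * pell (Suc m) ^ j * pell m ^ (k - j) * pell j)"
proof -
  define M N where "M = real (pell (Suc m))" and "N = real (pell m)"
  have pow: "x ^ Suc m = M * x + N" if "x\<^sup>2 = 2 * x + 1" for x :: real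
    unfolding M_def N_def
  proof (induction m)
    case (Suc m)
    have "x ^ Suc (Suc m) = x * (real (pell (Suc m)) * x + real (pell m))" by (simp flip: Suc)
    also have "\<dots> = real (pell (Suc m)) * x\<^sup>2 + real (pell m) * x" by (simp add: algebra_simps power2_eq_square)
    also have "\<dots> = real (pell (Suc (Suc m))) * x + real (pell (Suc m))"
      unfolding that by (simp add: algebra_simps)
    finally show ?case .
  qed simp
  have pow': "x ^ (Suc m * k) = (\<Sum>j\<le>k. real (k choose j) * M ^ j * N ^ (k - j) * x ^ j)" if "x\<^sup>2 = 2 * x + 1" for x :: real
    unfolding power_mult pow[OF that] binomial_ring by (intro sum.cong) (simp_all add: power_mult_distrib)
  have sq: "(1 + sqrt 2)\<^sup>2 = 2 * (1 + sqrt 2) + (1::real)" "(1 - sqrt 2)\<^sup>2 = 2 * (1 - sqrt 2) + (1::real)"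
    by (simp_all add: power2_eq_square algebra_simps)
  have "2 * sqrt 2 * real (pell (Suc m * k)) =
     (\<Sum>j\<le>k. real (k choose j) * M ^ j * N ^ (k - j) * ((1 + sqrt 2) ^ j - (1 - sqrt 2) ^ j))"
    unfolding pell_binet pow'[OF sq(1)] pow'[OF sq(2)] by (simp only: sum_subtractf right_diff_distrib)
  also have "\<dots> = 2 * sqrt 2 * (\<Sum>j\<le>k. real (k choose j) * M ^ j * N ^ (k - j) * real (pell j))"
    unfolding pell_binet[symmetric] sum_distrib_left by (intro sum.cong) (simp_all add: mult_ac)
  finally have "real (pell (Suc m * k)) = (\<Sum>j\<le>k. real (k choose j) * M ^ j * N ^ (k - j) * real (pell j))"
    by simp
  also have "\<dots> = real (\<Sum>j\<le>k. (k choose j) * pell (Suc m) ^ j * pell m ^ (k - j) * pell j)"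
    by (simp add: M_def N_def)
  finally show ?thesis by (simp only: of_nat_eq_iff)
qed

text \<open>The term j = 0 vanishes as P_0 = 0, and all terms from j = 2 on contain P_m twice. Hence
  P_(mk)/P_m is congruent to k P_(m-1)^(k-1) modulo P_m, the source of lifting the exponent.\<close>

lemma pell_mult_expand:
  assumes "m > 0" "k > 0"
  shows "pell (m * k) = pell m * (k * pell (m - 1) ^ (k - 1) +
     pell m * (\<Sum>j=2..k. (k choose j) * pell m ^ (j - 2) * pell (m - 1) ^ (k - j) * pell j))"
proof -
  obtain n where m: "m = Suc n" using assms(1) by (cases m) auto
  define f where "f j = (k choose j) * pell m ^ j * pell n ^ (k - j) * pell j" for j
  have "pell (m * k) = (\<Sum>j\<le>k. f j)" unfolding m f_def by (rule pell_mult_eq_sum)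
  also have "{..k} = insert 0 (insert 1 {2..k})" using assms(2) by auto
  also have "(\<Sum>j\<in>\<dots>. f j) = f 0 + (f 1 + (\<Sum>j=2..k. f j))" by simp
  also have "(\<Sum>j=2..k. f j) = pell m * pell m * (\<Sum>j=2..k. (k choose j) * pell m ^ (j - 2) * pell n ^ (k - j) * pell j)"
    unfolding sum_distrib_left f_def
  proof (intro sum.cong refl)
    fix j assume "j \<in> {2..k}"
    then have "pell m ^ j = pell m * pell m * pell m ^ (j - 2)"
      by (metis atLeastAtMost_iff le_add_diff_inverse power2_eq_square power_add)
    then show "(k choose j) * pell m ^ j * pell n ^ (k - j) * pell j =
        pell m * pell m * ((k choose j) * pell m ^ (j - 2) * pell n ^ (k - j) * pell j)" by simp
  qed
  also have "f 0 = 0" by (simp add: f_def)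
  also have "f 1 = pell m * (k * pell n ^ (k - 1))" by (simp add: f_def)
  finally show ?thesis using m by (simp add: algebra_simps)
qed

section \<open>Lifting the exponent\<close>

lemma multiplicity_mult_not_dvd:
  assumes "prime p" "\<not> p dvd x" "(a::nat) > 0"
  shows "multiplicity p (a * x) = multiplicity p a"
proof -
  have "x \<noteq> 0" using assms(2) by (metis dvd_0_right)
  then show ?thesis
    using assms by (simp add: prime_elem_multiplicity_mult_distrib not_dvd_imp_multiplicity_0)
qed

lemma multiplicity_pell_mult_not_dvd:
  assumes p: "prime p" "m > 0" "p dvd pell m" and k: "\<not> p dvd k"
  shows "multiplicity p (pell (m * k)) = multiplicity p (pell m)"
proof -
  have "k > 0" using k by (cases k) auto
  have "\<not> p dvd pell (m - 1)"
    using p coprime_pell_Suc[of "m - 1"] by (metis Suc_diff_1 coprime_common_divisor not_prime_unit)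
  then have "\<not> p dvd k * pell (m - 1) ^ (k - 1)"
    using k p(1) by (simp add: prime_dvd_mult_iff prime_dvd_power_iff) (metis prime_dvd_power)
  then have "\<not> p dvd (k * pell (m - 1) ^ (k - 1) + pell m * x)" for x
    using p by (simp add: dvd_add_left_iff)
  then show ?thesis
    unfolding pell_mult_expand[OF p(2) \<open>k > 0\<close>] using p pell_pos by (intro multiplicity_mult_not_dvd) auto
qed

text \<open>The quotient P_(mp)/P_m is p times a unit modulo p: the leading term p P_(m-1)^(p-1) has
  exactly one factor p, while the remaining sum is divisible by p and is multiplied by P_m, which
  brings a second one.\<close>

lemma multiplicity_pell_mult_prime:
  assumes p: "prime p" "m > 0" "p dvd pell m"
  shows "multiplicity p (pell (m * p)) = Suc (multiplicity p (pell m))"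
proof -
  have "p > 0" "p \<ge> 2" using p(1) by (simp_all add: prime_gt_0_nat prime_ge_2_nat)
  define N where "N = pell (m - 1)"
  have N: "\<not> p dvd N"
    using p coprime_pell_Suc[of "m - 1"] unfolding N_def by (metis Suc_diff_1 coprime_common_divisor not_prime_unit)
  define f where "f j = (p choose j) * pell m ^ (j - 2) * N ^ (p - j) * pell j" for j
  have "p dvd f j" if j: "j \<in> {2..p}" for j
  proof (cases "j = p")
    case False
    then have "p dvd (p choose j)" using j p(1) by (intro dvd_choose_prime) auto
    then show ?thesis by (simp add: f_def)
  next
    case True
    show ?thesis
    proof (cases "p = 2")
      \<comment> \<open>For p = 2 the power of P_m in the last summand has exponent 0; the factor p
        comes from P_2 = 2 instead. Thus the prime 2 is no exception to the rule.\<close>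
      case True
      then show ?thesis using \<open>j = p\<close> by (simp add: f_def numeral_2_eq_2)
    next
      case False
      then have "p - 2 > 0" using \<open>p \<ge> 2\<close> by simp
      then have "p dvd pell m ^ (p - 2)" using p(3) by (meson dvd_power dvd_trans)
      then show ?thesis using \<open>j = p\<close> by (simp add: f_def)
    qed
  qed
  then have "p dvd (\<Sum>j=2..p. f j)" by (rule dvd_sum)
  then obtain x where x: "(\<Sum>j=2..p. f j) = p * x" by (elim dvdE)
  have "pell (m * p) = pell m * (p * N ^ (p - 1) + pell m * (\<Sum>j=2..p. f j))"
    unfolding f_def N_def by (rule pell_mult_expand[OF p(2) \<open>p > 0\<close>])
  also have "\<dots> = (pell m * p) * (N ^ (p - 1) + pell m * x)" unfolding x by (simp add: algebra_simps)
  finally have eq: "pell (m * p) = (pell m * p) * (N ^ (p - 1) + pell m * x)" .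
  have "\<not> p dvd N ^ (p - 1)" using N p(1) prime_dvd_power by blast
  then have "\<not> p dvd N ^ (p - 1) + pell m * x" using p(3) by (simp add: dvd_add_left_iff)
  then have "multiplicity p (pell (m * p)) = multiplicity p (pell m * p)"
    unfolding eq using p pell_pos \<open>p > 0\<close> by (intro multiplicity_mult_not_dvd) auto
  also have "\<dots> = Suc (multiplicity p (pell m))"
    using p pell_pos[OF p(2)] by (simp add: prime_elem_multiplicity_mult_distrib)
  finally show ?thesis .
qed

lemma multiplicity_pell_mult:
  assumes p: "prime p" "m > 0" "p dvd pell m" and "k > 0"
  shows "multiplicity p (pell (m * k)) = multiplicity p (pell m) + multiplicity p k"
  using assms(4)
proof (induction k rule: less_induct)
  case (less k)
  show ?case
  proof (cases "p dvd k")
    case False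
    then show ?thesis
      using multiplicity_pell_mult_not_dvd[OF p] by (simp add: not_dvd_imp_multiplicity_0)
  next
    case True
    then obtain l where k: "k = l * p" by (metis dvdE mult.commute)
    have l: "l > 0" "l < k" using less.prems k p(1) prime_gt_1_nat[OF p(1)] by auto
    have "p dvd pell (m * l)" using p prime_dvd_pell_iff[OF p] by simp
    have "multiplicity p (pell (m * k)) = Suc (multiplicity p (pell (m * l)))"
      unfolding k mult.assoc[symmetric] using p l \<open>p dvd pell (m * l)\<close> by (intro multiplicity_pell_mult_prime) auto
    also have "\<dots> = multiplicity p (pell m) + Suc (multiplicity p l)" using less.IH[OF l(2,1)] by simp
    also have "Suc (multiplicity p l) = multiplicity p k"
      unfolding k using p(1) l by (simp add: prime_elem_multiplicity_mult_distrib)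
    finally show ?thesis .
  qed
qed

text \<open>
  The exponent of \<open>p\<close> in the homogenised cyclotomic value \<open>\<Phi>\<^sub>n(\<alpha>, \<beta>)\<close>, where \<open>\<beta> = 1 - \<surd>2\<close>. The last case
  is that of an intrinsic prime factor, which then divides \<open>n\<close>.
\<close>

definition prim_exponent :: "nat \<Rightarrow> nat \<Rightarrow> nat" where
  "prim_exponent p n =
     (if \<not> p dvd pell n then 0 else if n = pell_rank p then multiplicity p (pell n)
      else if \<exists>k. n = pell_rank p * p ^ k then 1 else 0)"

text \<open>Assembled from prescribed exponents, so that it is an integer of known factorisation by
  construction; that it equals the cyclotomic value is proved by comparing products over
  divisors.\<close>

definition prim_part :: "nat \<Rightarrow> nat" where
  "prim_part n = (\<Prod>p\<in>prime_factors (pell n). p ^ prim_exponent p n)"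

lemma multiplicity_prim_part:
  assumes "prime p" "n > 0"
  shows "multiplicity p (prim_part n) = prim_exponent p n"
proof (cases "p dvd pell n")
  case True
  then have "p \<in> prime_factors (pell n)"
    using assms pell_pos[OF assms(2)] by (auto simp: in_prime_factors_iff)
  then show ?thesis
    unfolding prim_part_def using assms
    by (subst multiplicity_prod_prime_powers) (auto simp: in_prime_factors_iff)
next
  case False
  then have "p \<notin> prime_factors (pell n)" by auto
  with False show ?thesis
    unfolding prim_part_def using assms
    by (subst multiplicity_prod_prime_powers) (auto simp: in_prime_factors_iff prim_exponent_def)
qed

lemma prim_part_pos: "n > 0 \<Longrightarrow> prim_part n > 0"
  unfolding prim_part_def by (intro prod_pos) (auto simp: in_prime_factors_iff intro: prime_gt_0_nat)

text \<open>Only the divisors r p^k contribute, r being the rank. The one with k = 0 gives the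
  exponent of p in P_r, each further one gives 1, and lifting the exponent says that the total is
  right.\<close>

lemma sum_prim_exponent:
  assumes p: "prime p" and n: "n > 0"
  shows "(\<Sum>d | d dvd n. prim_exponent p d) = multiplicity p (pell n)"
proof (cases "p dvd pell n")
  case False
  have "\<not> p dvd pell d" if "d dvd n" for d
  proof
    assume *: "p dvd pell d"
    have "d > 0" using that n by (auto intro: Nat.gr0I)
    from prime_dvd_pell_iff[OF p this *] * False that show False by (meson dvd_trans)
  qed
  then show ?thesis using False by (auto simp: prim_exponent_def not_dvd_imp_multiplicity_0)
next
  case True
  define r where "r = pell_rank p"
  have r: "r > 0" "p dvd pell r" using pell_rank[OF n True] by (simp_all add: r_def)
  note iff = prime_dvd_pell_iff[OF p n True, folded r_def]
  obtain m where m: "n = r * m" using iff True by (auto elim: dvdE)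
  have "m > 0" using n m by (auto intro: Nat.gr0I)
  have "p > 1" using p by (rule prime_gt_1_nat)
  define v where "v = multiplicity p m"
  have dvd: "r * p ^ k dvd n \<longleftrightarrow> k \<le> v" for k
    using r \<open>p > 1\<close> \<open>m > 0\<close> unfolding m v_def by (simp add: power_dvd_iff_le_multiplicity)
  have "(\<Sum>d | d dvd n. prim_exponent p d) = (\<Sum>d\<in>(\<lambda>k. r * p ^ k) ` {..v}. prim_exponent p d)"
  proof (rule sum.mono_neutral_right)
    show "\<forall>d\<in>{d. d dvd n} - (\<lambda>k. r * p ^ k) ` {..v}. prim_exponent p d = 0"
    proof
      fix d assume d: "d \<in> {d. d dvd n} - (\<lambda>k. r * p ^ k) ` {..v}"
      have "\<not> (\<exists>k. d = r * p ^ k)" using d dvd by auto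
      moreover from this have "d \<noteq> r" by (metis mult.right_neutral power_0)
      ultimately show "prim_exponent p d = 0" unfolding prim_exponent_def r_def by simp
    qed
  qed (use n dvd in auto)
  also have "\<dots> = (\<Sum>k\<le>v. prim_exponent p (r * p ^ k))"
    using r \<open>p > 1\<close> by (subst sum.reindex) (auto simp: inj_on_def power_inject_exp)
  also have "\<dots> = (\<Sum>k\<le>v. if k = 0 then multiplicity p (pell r) else 1)"
    using r iff \<open>p > 1\<close> by (intro sum.cong) (auto simp: prim_exponent_def r_def[symmetric] power_0_left)
  also have "\<dots> = multiplicity p (pell r) + v"
    by (subst sum.atMost_shift) simp
  also have "\<dots> = multiplicity p (pell n)"
    unfolding m v_def using multiplicity_pell_mult[OF p r \<open>m > 0\<close>] by simp
  finally show ?thesis .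
qed

lemma prod_prim_part:
  assumes "n > 0"
  shows "(\<Prod>d | d dvd n. prim_part d) = pell n"
proof (rule multiplicity_eq_nat)
  have pos: "d > 0" if "d dvd n" for d using that assms by (auto intro: Nat.gr0I)
  show "(\<Prod>d | d dvd n. prim_part d) > 0"
    using pos by (intro prod_pos) (auto intro: prim_part_pos)
  fix p :: nat assume p: "prime p"
  have "multiplicity p (\<Prod>d | d dvd n. prim_part d) = (\<Sum>d | d dvd n. multiplicity p (prim_part d))"
    using p assms pos prim_part_pos by (intro prime_elem_multiplicity_prod_distrib) (auto, metis less_not_refl)
  also have "\<dots> = (\<Sum>d | d dvd n. prim_exponent p d)"
    using p pos by (intro sum.cong) (auto intro: multiplicity_prim_part)
  finally show "multiplicity p (\<Prod>d | d dvd n. prim_part d) = multiplicity p (pell n)"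
    using sum_prim_exponent[OF p assms] by simp
qed (rule pell_pos[OF assms])

section \<open>Primitive roots of unity and cyclotomic values\<close>

definition prim_roots :: "nat \<Rightarrow> complex set" where
  "prim_roots n = {z. z ^ n = 1 \<and> (\<forall>m. 0 < m \<and> m < n \<longrightarrow> z ^ m \<noteq> 1)}"

lemma finite_prim_roots: "n > 0 \<Longrightarrow> finite (prim_roots n)"
  by (rule finite_subset[OF _ finite_roots_unity[of n]]) (auto simp: prim_roots_def)

lemma prim_roots_least:
  fixes z :: complex
  assumes "z ^ n = 1" "n > 0"
  obtains d where "d dvd n" "d > 0" "z \<in> prim_roots d"
proof -
  define d where "d = (LEAST d. d > 0 \<and> z ^ d = 1)"
  have d: "d > 0 \<and> z ^ d = 1" unfolding d_def by (rule LeastI[of _ n]) (use assms in auto)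
  have min: "z ^ m \<noteq> 1" if "0 < m" "m < d" for m
    using not_less_Least[of m "\<lambda>d. d > 0 \<and> z ^ d = 1"] that unfolding d_def[symmetric] by auto
  have "z ^ n = (z ^ d) ^ (n div d) * z ^ (n mod d)"
    by (metis mult_div_mod_eq power_add power_mult)
  then have "z ^ (n mod d) = 1" using d assms by simp
  then have "n mod d = 0" using min[of "n mod d"] d by auto
  then show ?thesis using that[of d] d min by (auto simp: prim_roots_def)
qed

lemma roots_unity_eq_UN:
  assumes "n > 0"
  shows "{z::complex. z ^ n = 1} = (\<Union>d\<in>{d. d dvd n}. prim_roots d)"
proof safe
  fix z :: complex assume "z ^ n = 1"
  then show "z \<in> (\<Union>d\<in>{d. d dvd n}. prim_roots d)" using prim_roots_least assms by blast
next
  fix z d assume "d dvd n" "z \<in> prim_roots d"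
  then show "z ^ n = 1" by (auto simp: prim_roots_def power_mult elim!: dvdE)
qed

lemma prim_roots_disjoint:
  assumes "z \<in> prim_roots a" "z \<in> prim_roots b" "a > 0" "b > 0"
  shows "a = b"
  using assms by (cases a b rule: linorder_cases) (auto simp: prim_roots_def)

lemma prod_prim_roots:
  fixes f :: "complex \<Rightarrow> 'a::comm_monoid_mult"
  assumes "n > 0"
  shows "(\<Prod>d | d dvd n. \<Prod>z\<in>prim_roots d. f z) = (\<Prod>z | z ^ n = 1. f z)"
proof -
  have pos: "d > 0" if "d dvd n" for d using that assms by (auto intro: Nat.gr0I)
  have "\<forall>i\<in>{d. d dvd n}. \<forall>j\<in>{d. d dvd n}. i \<noteq> j \<longrightarrow> prim_roots i \<inter> prim_roots j = {}"
    using pos by (auto dest: prim_roots_disjoint)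
  moreover have "\<forall>i\<in>{d. d dvd n}. finite (prim_roots i)" using pos finite_prim_roots by blast
  ultimately show ?thesis
    unfolding roots_unity_eq_UN[OF assms] using assms by (subst prod.UNION_disjoint) auto
qed

text \<open>Both sides have divisor sum n, which determines them by induction; no parametrisation of
  the roots is required.\<close>

lemma card_prim_roots:
  assumes "n > 0"
  shows "card (prim_roots n) = totient n"
  using assms
proof (induction n rule: less_induct)
  case (less n)
  have pos: "d > 0" if "d dvd n" for d using that less.prems by (auto intro: Nat.gr0I)
  have "\<forall>i\<in>{d. d dvd n}. \<forall>j\<in>{d. d dvd n}. i \<noteq> j \<longrightarrow> prim_roots i \<inter> prim_roots j = {}"
    using pos by (auto dest: prim_roots_disjoint)
  moreover have "\<forall>i\<in>{d. d dvd n}. finite (prim_roots i)" using pos finite_prim_roots by blast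
  ultimately have "(\<Sum>d | d dvd n. card (prim_roots d)) = card (\<Union>d\<in>{d. d dvd n}. prim_roots d)"
    using less.prems by (subst card_UN_disjoint) auto
  also have "\<dots> = n"
    unfolding roots_unity_eq_UN[OF less.prems, symmetric] using less.prems by (intro card_roots_unity_eq)
  also have "\<dots> = (\<Sum>d | d dvd n. totient d)" by (rule totient_divisor_sum[symmetric])
  finally have eq: "(\<Sum>d | d dvd n. card (prim_roots d)) = (\<Sum>d | d dvd n. totient d)" .
  have split: "{d. d dvd n} = insert n {d. d dvd n \<and> d < n}"
    using less.prems by (auto dest: dvd_imp_le)
  have "(\<Sum>d | d dvd n \<and> d < n. card (prim_roots d)) = (\<Sum>d | d dvd n \<and> d < n. totient d)"
    using less.IH pos by (intro sum.cong) auto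
  with eq less.prems show ?case unfolding split by simp
qed

text \<open>Two monic polynomials of degree n that agree at the n roots of unity are equal; the
  result at x/y is then cleared of denominators.\<close>

lemma prod_roots_unity:
  fixes x y :: complex
  assumes "n > 0"
  shows "(\<Prod>z | z ^ n = 1. x - z * y) = x ^ n - y ^ n"
proof (cases "y = 0")
  case True
  then show ?thesis using assms by (simp add: card_roots_unity_eq)
next
  case False
  have fin: "finite {z::complex. z ^ n = 1}" using assms by (intro finite_roots_unity) auto
  define p :: "complex poly" where "p = (\<Prod>z | z ^ n = 1. [:- z, 1:])"
  define q :: "complex poly" where "q = monom 1 n - 1"
  have deg: "degree p = n"
    unfolding p_def using assms by (subst degree_prod_eq_sum_degree) (auto simp: card_roots_unity_eq)
  have "lead_coeff p = 1" unfolding p_def lead_coeff_prod by simp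
  have "p = q"
  proof (rule poly_eqI_degree_lead_coeff[of _ n])
    show "coeff p n = coeff q n" using \<open>lead_coeff p = 1\<close> deg assms by (simp add: q_def)
    show "n \<le> card {z::complex. z ^ n = 1}" using assms by (simp add: card_roots_unity_eq)
    show "degree q \<le> n" unfolding q_def by (intro degree_diff_le) (auto simp: degree_monom_le)
    show "poly p z = poly q z" if "z \<in> {z. z ^ n = 1}" for z
      using that fin by (auto simp: p_def q_def poly_prod poly_monom)
  qed (use deg in auto)
  then have "poly p (x / y) = poly q (x / y)" by simp
  then have "(\<Prod>z | z ^ n = 1. x / y - z) = (x / y) ^ n - 1" by (simp add: p_def q_def poly_prod poly_monom)
  then have "y ^ n * (\<Prod>z | z ^ n = 1. x / y - z) = x ^ n - y ^ n"
    using False by (simp add: power_divide field_simps)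
  also have "y ^ n * (\<Prod>z | z ^ n = 1. x / y - z) = (\<Prod>z | z ^ n = 1. y * (x / y - z))"
    using assms by (simp add: prod.distrib card_roots_unity_eq)
  also have "\<dots> = (\<Prod>z | z ^ n = 1. x - z * y)"
    using False by (intro prod.cong) (auto simp: field_simps)
  finally show ?thesis .
qed

text \<open>The absolute value of the homogenised cyclotomic polynomial at the two roots. Taking
  norms factor by factor keeps it real and gives each factor its own lower bound.\<close>

definition pell_cyclotomic :: "nat \<Rightarrow> real" where
  "pell_cyclotomic n = (\<Prod>z\<in>prim_roots n. norm (of_real (1 + sqrt 2) - z * of_real (1 - sqrt 2)))"

lemma prod_pell_cyclotomic:
  assumes "n > 0"
  shows "(\<Prod>d | d dvd n. pell_cyclotomic d) = 2 * sqrt 2 * real (pell n)"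
proof -
  have "(\<Prod>d | d dvd n. pell_cyclotomic d) =
        norm (\<Prod>z | z ^ n = 1. of_real (1 + sqrt 2) - z * complex_of_real (1 - sqrt 2))"
    unfolding pell_cyclotomic_def prod_prim_roots[OF assms] by (rule prod_norm)
  also have "\<dots> = norm (complex_of_real ((1 + sqrt 2) ^ n - (1 - sqrt 2) ^ n))"
    unfolding prod_roots_unity[OF assms] by simp
  also have "\<dots> = 2 * sqrt 2 * real (pell n)"
    unfolding pell_binet[symmetric] norm_of_real by simp
  finally show ?thesis .
qed

text \<open>The two divisor products differ by the factor 2 sqrt 2, which is exactly the cyclotomic
  value at d = 1. Proper divisors from 2 on cancel by induction, leaving the factor at n.\<close>

lemma pell_cyclotomic_eq_prim_part:
  assumes "n \<ge> 2"
  shows "pell_cyclotomic n = real (prim_part n)"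
  using assms
proof (induction n rule: less_induct)
  case (less n)
  have pos: "d > 0" if "d dvd n" for d using that less.prems by (auto intro: Nat.gr0I)
  have split: "{d. d dvd n} = insert n (insert 1 {d. d dvd n \<and> d < n \<and> 2 \<le> d})"
    using less.prems pos by (auto dest: dvd_imp_le) (metis One_nat_def Suc_leI antisym_conv3 not_less_eq_eq numeral_2_eq_2)
  define P where "P = (\<Prod>d | d dvd n \<and> d < n \<and> 2 \<le> d. real (prim_part d))"
  have P: "P > 0" unfolding P_def using pos prim_part_pos by (intro prod_pos) auto
  have one: "pell_cyclotomic 1 = 2 * sqrt 2"
    using prod_pell_cyclotomic[of 1] by simp
  have one': "prim_part 1 = 1" using prod_prim_part[of 1] by simp
  have "(\<Prod>d | d dvd n. pell_cyclotomic d) = 2 * sqrt 2 * (\<Prod>d | d dvd n. real (prim_part d))"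
    using less.prems prod_pell_cyclotomic[of n] prod_prim_part[of n] by (simp flip: of_nat_prod)
  moreover have "(\<Prod>d | d dvd n. pell_cyclotomic d) = pell_cyclotomic n * (2 * sqrt 2 * P)"
  proof -
    have "(\<Prod>d | d dvd n \<and> d < n \<and> 2 \<le> d. pell_cyclotomic d) = P"
      unfolding P_def using less.IH by (intro prod.cong) auto
    then show ?thesis unfolding split using less.prems one by simp
  qed
  moreover have "(\<Prod>d | d dvd n. real (prim_part d)) = real (prim_part n) * P"
    unfolding split P_def using less.prems one' by simp
  ultimately show ?case using P by simp
qed

text \<open>
  Each factor satisfies \<open>\<bar>\<alpha> - z \<beta>\<bar> \<ge> \<alpha> - \<bar>\<beta>\<bar> = 2\<close>, with equality only for \<open>z = -1\<close>.
\<close>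

lemma pell_cyclotomic_gt:
  assumes "n \<ge> 3"
  shows "pell_cyclotomic n > 2 ^ totient n"
proof -
  have gt: "norm (of_real (1 + sqrt 2) - z * of_real (1 - sqrt 2)) > 2" if z: "z \<in> prim_roots n" for z
  proof -
    have "z ^ n = 1" using z by (simp add: prim_roots_def)
    then have nz: "norm z = 1" using assms
      by (metis norm_one norm_power power_eq_1_iff less_le_trans norm_ge_zero zero_less_numeral not_less0 le_zero_eq not_numeral_le_zero neq0_conv abs_norm_cancel)
    have "z ^ 2 \<noteq> 1" using z assms by (simp add: prim_roots_def)
    then have "z \<noteq> -1" by auto
    have Re: "Re z > - 1"
    proof (rule ccontr)
      assume "\<not> Re z > -1"
      then have "Re z = - 1" using abs_Re_le_cmod[of z] nz by linarith
      moreover have "(Re z)\<^sup>2 + (Im z)\<^sup>2 = 1" using nz cmod_power2[of z] by simp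
      ultimately have "z = -1" by (simp add: complex_eq_iff)
      with \<open>z \<noteq> -1\<close> show False by simp
    qed
    have "2 < (1 + sqrt 2) + Re z * (sqrt 2 - 1)"
    proof -
      have "(- 1) * (sqrt 2 - 1) < Re z * (sqrt 2 - 1)"
        using Re sqrt2_bounds by (intro mult_strict_right_mono) auto
      then show ?thesis by (simp add: algebra_simps)
    qed
    also have "\<dots> = Re (of_real (1 + sqrt 2) - z * of_real (1 - sqrt 2))" by (simp add: algebra_simps)
    also have "\<dots> \<le> norm (of_real (1 + sqrt 2) - z * of_real (1 - sqrt 2))" by (rule complex_Re_le_cmod)
    finally show ?thesis .
  qed
  have "card (prim_roots n) > 0" using assms by (subst card_prim_roots) auto
  then obtain w where w: "w \<in> prim_roots n" "finite (prim_roots n)" by (auto simp: card_gt_0_iff)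
  have "(\<Prod>z\<in>prim_roots n. 2 :: real) < pell_cyclotomic n"
    unfolding pell_cyclotomic_def
  proof (rule prod_mono_strict[of w])
    show "w \<in> prim_roots n" "finite (prim_roots n)" by (fact w)+
    show "2 < norm (of_real (1 + sqrt 2) - w * of_real (1 - sqrt 2))" by (rule gt[OF w(1)])
    fix z assume "z \<in> prim_roots n"
    from gt[OF this] show "(0::real) \<le> 2 \<and> 2 \<le> norm (of_real (1 + sqrt 2) - z * of_real (1 - sqrt 2))"
      and "0 < norm (of_real (1 + sqrt 2) - z * of_real (1 - sqrt 2))" by linarith+
  qed
  then show ?thesis using assms by (simp add: card_prim_roots)
qed

text \<open>Each p is at most 2^(p-1), and a + b \<le> a b for a, b \<ge> 2 merges the exponents.
  This is why 2 must be excluded: it would make a = 1.\<close>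

lemma prod_le_two_power_prod:
  assumes "finite S" "\<And>p. p \<in> S \<Longrightarrow> p \<ge> (3::nat)"
  shows "(\<Prod>p\<in>S. p) \<le> 2 ^ (\<Prod>p\<in>S. p - 1)"
  using assms
proof (induction S rule: finite_induct)
  case (insert p S)
  have IH: "\<Prod>S \<le> 2 ^ (\<Prod>p\<in>S. p - 1)" using insert by auto
  show ?case
  proof (cases "S = {}")
    case True
    have "p - 1 < 2 ^ (p - 1)" by (rule less_exp)
    then have "p \<le> 2 ^ (p - 1)" by linarith
    then show ?thesis using True by simp
  next
    case False
    have "p - 1 < 2 ^ (p - 1)" by (rule less_exp)
    then have p: "p \<le> 2 ^ (p - 1)" by linarith
    have p2: "p - 1 \<ge> 2" using insert.prems[of p] by simp
    have S2: "(\<Prod>p\<in>S. p - 1) \<ge> 2"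
    proof -
      obtain q where q: "q \<in> S" using False by auto
      have "1 \<le> x - 1" if "x \<in> S - {q}" for x using insert.prems[of x] that by simp
      then have "1 \<le> (\<Prod>p\<in>S - {q}. p - 1)" by (rule prod_ge_1)
      moreover have "2 \<le> q - 1" using insert.prems[of q] q by simp
      ultimately have "2 * 1 \<le> (q - 1) * (\<Prod>p\<in>S - {q}. p - 1)" by (intro mult_mono) auto
      also have "\<dots> = (\<Prod>p\<in>S. p - 1)" using insert.hyps q by (simp add: prod.remove[of S q])
      finally show ?thesis by simp
    qed
    have "a + b \<le> a * b" if ab: "a \<ge> 2" "b \<ge> 2" for a b :: nat
    proof -
      obtain c where "a = 2 + c" using le_Suc_ex[OF ab(1)] by blast
      moreover obtain d where "b = 2 + d" using le_Suc_ex[OF ab(2)] by blast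
      ultimately show ?thesis by (simp add: algebra_simps)
    qed
    from this[OF p2 S2] have "(p - 1) + (\<Prod>p\<in>S. p - 1) \<le> (p - 1) * (\<Prod>p\<in>S. p - 1)" .
    then have "2 ^ (p - 1) * 2 ^ (\<Prod>p\<in>S. p - 1) \<le> (2::nat) ^ ((p - 1) * (\<Prod>p\<in>S. p - 1))"
      unfolding power_add[symmetric] by (intro power_increasing) auto
    moreover have "p * \<Prod>S \<le> 2 ^ (p - 1) * 2 ^ (\<Prod>p\<in>S. p - 1)" using p IH by (intro mult_mono) auto
    ultimately show ?thesis using insert.hyps by simp
  qed
qed simp

lemma prod_primes_dvd:
  assumes "finite S" "\<And>p. p \<in> S \<Longrightarrow> prime p \<and> p dvd (n::nat)"
  shows "\<Prod>S dvd n"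
  using assms
proof (induction S rule: finite_induct)
  case (insert p S)
  have "coprime p (\<Prod>S)"
    using insert by (intro prod_coprime_right) (auto intro: primes_coprime)
  then have "p * \<Prod>S dvd n" using insert by (intro divides_mult) auto
  then show ?case using insert.hyps by simp
qed simp

text \<open>
  Without a primitive prime, \<open>\<Phi>\<^sub>n(\<alpha>, \<beta>)\<close> is a product of distinct primes dividing \<open>n\<close>, which is at
  most \<open>2\<close> to the power \<open>totient n\<close>.
\<close>

theorem pell_primitive_divisor:
  assumes "n \<ge> 2"
  obtains p where "prime p" "p dvd pell n" "\<And>m. 0 < m \<Longrightarrow> m < n \<Longrightarrow> \<not> p dvd pell m"
proof -
  have "\<exists>p. prime p \<and> p dvd pell n \<and> pell_rank p = n"
  proof (cases "n = 2")
    \<comment> \<open>The strict cyclotomic bound fails at n = 2, where the only root z = -1 gives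
      the value 2 = 2^1, so P_2 = 2 is inspected directly.\<close>
    case True
    have "pell_rank 2 \<le> 2" "pell_rank 2 > 0" "2 dvd pell (pell_rank 2)" using pell_rank[of 2 2] by (auto simp: numeral_2_eq_2)
    moreover have "pell_rank 2 \<noteq> 1"
    proof
      assume "pell_rank 2 = 1"
      with \<open>2 dvd pell (pell_rank 2)\<close> show False by simp
    qed
    ultimately have "pell_rank 2 = 2" by linarith
    then show ?thesis
      using True two_is_prime_nat \<open>2 dvd pell (pell_rank 2)\<close> by metis
  next
    case False
    then have n: "n \<ge> 3" using assms by simp
    show ?thesis
    proof (rule ccontr)
      assume "\<not> ?thesis"
      then have nr: "pell_rank p \<noteq> n" if "prime p" "p dvd pell n" for p using that by blast
      \<comment> \<open>If no prime has rank n, the second branch of \<open>prim_exponent\<close>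
        never applies, and exactly the primes of this set survive, each to the first power.\<close>
      define S where "S = {p \<in> prime_factors (pell n). \<exists>k. n = pell_rank p * p ^ k}"
      have S: "prime p" "p dvd pell n" "p dvd n" if pS: "p \<in> S" for p
      proof -
        show *: "prime p" "p dvd pell n" using pS by (auto simp: S_def)
        obtain k where k: "n = pell_rank p * p ^ k" using pS by (auto simp: S_def)
        have "k \<noteq> 0" using nr[OF *] k by (intro notI) simp
        then show "p dvd n" unfolding k by simp
      qed
      have "finite S" by (simp add: S_def)
      have "prim_part n = (\<Prod>p\<in>prime_factors (pell n). if p \<in> S then p else 1)"
        unfolding prim_part_def
      proof (intro prod.cong refl)
        fix p assume "p \<in> prime_factors (pell n)"
        then show "p ^ prim_exponent p n = (if p \<in> S then p else 1)"
          using nr[of p] by (auto simp: prim_exponent_def S_def)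
      qed
      also have "\<dots> = \<Prod>S"
        by (subst prod.inter_filter[symmetric]) (auto simp: S_def intro!: prod.cong)
      finally have eq: "prim_part n = \<Prod>S" .
      have "\<Prod>S \<le> 2 ^ totient n"
      proof (cases "2 \<in> S")
        \<comment> \<open>If 2 is in the set, then n divides a power of 2, which leaves no room for
          another prime.\<close>
        case True
        have rank2: "pell_rank 2 dvd 2" using prime_dvd_pell_iff[of 2 n 2] S[OF True] n by (auto simp: numeral_2_eq_2)
        obtain k where k: "n = pell_rank 2 * 2 ^ k" using True by (auto simp: S_def)
        have "p = 2" if "p \<in> S" for p
        proof -
          have "p dvd 2 * 2 ^ k" using S(3)[OF that] rank2 unfolding k by (meson dvd_trans mult_dvd_mono dvd_refl)
          then have "p dvd 2 ^ Suc k" by simp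
          then show ?thesis using S(1)[OF that]
            by (metis prime_dvd_power primes_dvd_imp_eq two_is_prime_nat)
        qed
        then have "S = {2}" using True by blast
        moreover have "totient n \<ge> 1" using n by (simp add: Suc_le_eq)
        then have "(2::nat) ^ 1 \<le> 2 ^ totient n" by (intro power_increasing) auto
        ultimately show ?thesis by simp
      next
        case False
        have "p \<ge> 3" if "p \<in> S" for p
          using prime_ge_2_nat[OF S(1)[OF that]] False that by (cases "p = 2") auto
        then have "\<Prod>S \<le> 2 ^ (\<Prod>p\<in>S. p - 1)" using \<open>finite S\<close> by (intro prod_le_two_power_prod) auto
        also have "(\<Prod>p\<in>S. p - 1) = totient (\<Prod>S)"
        proof -
          have "totient (\<Prod>p\<in>S. p) = (\<Prod>p\<in>S. totient p)"
            using S by (intro totient_prod_coprime) (auto simp: pairwise_def intro: primes_coprime)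
          also have "\<dots> = (\<Prod>p\<in>S. p - 1)" using S by (intro prod.cong) (auto simp: totient_prime)
          finally show ?thesis by simp
        qed
        also have "\<Prod>S dvd n"
          using S \<open>finite S\<close> by (intro prod_primes_dvd) auto
        then have "totient (\<Prod>S) \<le> totient n" using n by (intro totient_dvd_mono) auto
        then have "(2::nat) ^ totient (\<Prod>S) \<le> 2 ^ totient n" by (intro power_increasing) auto
        finally show ?thesis .
      qed
      then have "real (prim_part n) \<le> 2 ^ totient n" unfolding eq by (metis of_nat_le_iff of_nat_numeral of_nat_power)
      with pell_cyclotomic_gt[OF n] pell_cyclotomic_eq_prim_part[OF assms] show False by simp
    qed
  qed
  then obtain p where p: "prime p" "p dvd pell n" "pell_rank p = n" by blast
  show ?thesis
  proof (rule that[OF p(1,2)])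
    fix m assume "0 < m" "m < n"
    then show "\<not> p dvd pell m" using pell_rank(3)[of m p] p(3) by auto
  qed
qed

section \<open>Vertical translates\<close>

text \<open>A primitive prime of the largest index with nonzero coefficient divides no other P_j in
  the relation. Splitting the coefficients by sign gives an equation between natural numbers, in
  which the exponents of that prime must agree.\<close>

lemma ln_pell_independent:
  fixes c :: "nat \<Rightarrow> int"
  assumes "finite I" "\<And>i. i \<in> I \<Longrightarrow> i \<ge> 2" "(\<Sum>i\<in>I. of_int (c i) * ln (real (pell i))) = 0" "i \<in> I"
  shows "c i = 0"
proof (rule ccontr)
  assume "c i \<noteq> 0"
  define J where "J = {i\<in>I. c i \<noteq> 0}"
  define n where "n = Max J"
  have "finite J" "J \<noteq> {}" using assms \<open>c i \<noteq> 0\<close> by (auto simp: J_def)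
  then have n: "n \<in> J" "\<And>j. j \<in> J \<Longrightarrow> j \<le> n" by (simp_all add: n_def)
  then have "n \<ge> 2" using assms(2) by (auto simp: J_def)
  have pos: "pell j > 0" if "j \<in> J" for j using assms(2) that by (intro pell_pos) (force simp: J_def)
  obtain p where p: "prime p" "p dvd pell n" "\<And>m. 0 < m \<Longrightarrow> m < n \<Longrightarrow> \<not> p dvd pell m"
    using pell_primitive_divisor[OF \<open>n \<ge> 2\<close>] by blast
  have ln_prod: "ln (real (\<Prod>j\<in>J. pell j ^ f j)) = (\<Sum>j\<in>J. real (f j) * ln (real (pell j)))" for f
  proof -
    have "ln (real (\<Prod>j\<in>J. pell j ^ f j)) = ln (\<Prod>j\<in>J. real (pell j) ^ f j)" by simp
    also have "\<dots> = (\<Sum>j\<in>J. ln (real (pell j) ^ f j))"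
      using pos \<open>finite J\<close> by (intro ln_prod) auto
    also have "\<dots> = (\<Sum>j\<in>J. real (f j) * ln (real (pell j)))"
      using pos by (intro sum.cong) (auto simp: ln_realpow)
    finally show ?thesis .
  qed
  have mult: "multiplicity p (\<Prod>j\<in>J. pell j ^ f j) = f n * multiplicity p (pell n)" for f
  proof -
    have "multiplicity p (\<Prod>j\<in>J. pell j ^ f j) = (\<Sum>j\<in>J. multiplicity p (pell j ^ f j))"
      using p(1) \<open>finite J\<close> by (intro prime_elem_multiplicity_prod_distrib) (auto, metis pos less_not_refl)
    also have "\<dots> = (\<Sum>j\<in>J. if j = n then f n * multiplicity p (pell n) else 0)"
    proof (intro sum.cong refl)
      fix j assume j: "j \<in> J"
      have "j \<noteq> n \<Longrightarrow> multiplicity p (pell j) = 0"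
        using n(2)[OF j] j assms(2) by (intro not_dvd_imp_multiplicity_0 p(3)) (force simp: J_def)+
      then show "multiplicity p (pell j ^ f j) = (if j = n then f n * multiplicity p (pell n) else 0)"
        using p(1) pos[OF j] by (simp add: prime_elem_multiplicity_power_distrib)
    qed
    also have "\<dots> = f n * multiplicity p (pell n)" using n \<open>finite J\<close> by simp
    finally show ?thesis .
  qed
  have "(\<Sum>j\<in>J. of_int (c j) * ln (real (pell j))) = 0"
    using assms by (subst sum.mono_neutral_left[of I J]) (auto simp: J_def)
  moreover have "(\<Sum>j\<in>J. real (nat (c j)) * ln (real (pell j))) - (\<Sum>j\<in>J. real (nat (- c j)) * ln (real (pell j)))
      = (\<Sum>j\<in>J. of_int (c j) * ln (real (pell j)))"
    unfolding sum_subtractf[symmetric]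
  proof (intro sum.cong refl)
    fix j
    have "real (nat (c j)) - real (nat (- c j)) = of_int (c j)" by (cases "c j \<ge> 0") auto
    then show "real (nat (c j)) * ln (real (pell j)) - real (nat (- c j)) * ln (real (pell j)) =
        of_int (c j) * ln (real (pell j))" by (simp flip: left_diff_distrib)
  qed
  ultimately have ln_eq: "ln (real (\<Prod>j\<in>J. pell j ^ nat (c j))) = ln (real (\<Prod>j\<in>J. pell j ^ nat (- c j)))"
    unfolding ln_prod by linarith
  have "(\<Prod>j\<in>J. pell j ^ f j) > 0" for f using pos by (intro prod_pos) simp
  then have pos': "real (\<Prod>j\<in>J. pell j ^ f j) > 0" for f by (simp only: of_nat_0_less_iff)
  have "real (\<Prod>j\<in>J. pell j ^ nat (c j)) = real (\<Prod>j\<in>J. pell j ^ nat (- c j))"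
    by (rule ln_inj_iff[THEN iffD1, OF pos' pos' ln_eq])
  then have "(\<Prod>j\<in>J. pell j ^ nat (c j)) = (\<Prod>j\<in>J. pell j ^ nat (- c j))"
    by (simp only: of_nat_eq_iff)
  then have "nat (c n) * multiplicity p (pell n) = nat (- c n) * multiplicity p (pell n)"
    using mult by metis
  moreover have "multiplicity p (pell n) > 0"
    using p pos[OF n(1)] by (simp add: prime_multiplicity_gt_zero_iff)
  ultimately have "nat (c n) = nat (- c n)" by simp
  then have "c n = 0" by linarith
  with n(1) show False by (simp add: J_def)
qed

lemma inj_on_ln_pell: "inj_on (\<lambda>i. ln (real (pell (i + 2)))) A"
proof (rule inj_onI, rule ccontr)
  fix i j assume eq: "ln (real (pell (i + 2))) = ln (real (pell (j + 2)))" and "i \<noteq> j"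
  then have "(\<Sum>k\<in>{i + 2, j + 2}. of_int (if k = i + 2 then 1 else -1) * ln (real (pell k))) = 0" by simp
  then have "(if i + 2 = i + 2 then 1 else -1) = (0 :: int)" 
    by (intro ln_pell_independent[where I = "{i + 2, j + 2}" and c = "\<lambda>k. if k = i + 2 then 1 else -1" and i = "i + 2"]) auto
  then show False by simp
qed

lemma norm_cis_diff_le: "norm (cis a - cis b) \<le> \<bar>a - b\<bar>"
proof -
  have "cis a - cis b = cis b * (exp (\<i> * of_real (a - b)) - 1)"
    unfolding cis_conv_exp[symmetric] by (simp add: right_diff_distrib cis_mult)
  then have "norm (cis a - cis b) = norm (exp (\<i> * of_real (a - b)) - 1)" by (simp add: norm_mult)
  also have "\<dots> \<le> \<bar>a - b\<bar>"
    unfolding dist_exp_i_1 using abs_sin_x_le_abs_x[of "(a - b) / 2"] by simp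
  finally show ?thesis .
qed

definition pell_phase :: "real \<Rightarrow> nat \<Rightarrow> complex" where
  "pell_phase t n = cis (- t * ln (real (pell (Suc n))))"

text \<open>Kronecker's theorem is applied to the numbers ln P_2, ln P_3, ... and the targets - Arg
  / (2 pi). The phase at n = 0 is always 1, which forces the condition on
  \<open>z 0\<close>.\<close>

lemma pell_phase_dense:
  assumes z: "\<And>n. norm (z n) = 1" "z 0 = 1" and "\<epsilon> > 0"
  obtains t where "\<And>n. n \<le> N \<Longrightarrow> norm (pell_phase t n - z n) < \<epsilon>"
proof -
  \<comment> \<open>The reals as a module over the integers, so that \<open>independent\<close>
    refers to integer relations.\<close>
  interpret Modules.module "\<lambda>r. (*) (real_of_int r)"
    by (simp add: Modules.module.intro distrib_left mult.commute)
  define \<theta> where "\<theta> i = ln (real (pell (i + 2)))" for i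
  have indep: "independent (\<theta> ` {..<N})"
    unfolding independent_explicit_module
  proof (intro allI impI)
    fix t u v assume t: "finite t" "t \<subseteq> \<theta> ` {..<N}" "(\<Sum>v\<in>t. real_of_int (u v) * v) = 0" "v \<in> t"
    \<comment> \<open>Independence concerns a set of reals; injectivity of the logarithms translates
      a relation on it back to Pell indices, which are shifted by 2 against those of
      \<theta>.\<close>
    define I where "I = {i. i \<ge> 2 \<and> i < N + 2 \<and> \<theta> (i - 2) \<in> t}"
    have "t = (\<lambda>i. \<theta> (i - 2)) ` I"
    proof -
      have "x \<in> (\<lambda>i. \<theta> (i - 2)) ` I" if "x \<in> t" for x
      proof -
        obtain i where "i < N" "x = \<theta> i" using t(2) \<open>x \<in> t\<close> by auto
        then show ?thesis using \<open>x \<in> t\<close> by (intro image_eqI[of _ _ "i + 2"]) (auto simp: I_def)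
      qed
      then show ?thesis by (auto simp: I_def)
    qed
    have inj: "inj_on (\<lambda>i. \<theta> (i - 2)) I"
    proof (rule inj_onI)
      fix i j assume ij: "i \<in> I" "j \<in> I" "\<theta> (i - 2) = \<theta> (j - 2)"
      have "i - 2 = j - 2"
        using inj_onD[OF inj_on_ln_pell[of UNIV], of "i - 2" "j - 2"] ij(3) unfolding \<theta>_def by blast
      then show "i = j" using ij by (auto simp: I_def)
    qed
    have "(\<Sum>i\<in>I. of_int (u (\<theta> (i - 2))) * ln (real (pell i))) = (\<Sum>i\<in>I. of_int (u (\<theta> (i - 2))) * \<theta> (i - 2))"
      by (intro sum.cong) (auto simp: I_def \<theta>_def le_add_diff_inverse2 simp del: add_2_eq_Suc' add_2_eq_Suc)
    also have "\<dots> = (\<Sum>v\<in>t. real_of_int (u v) * v)"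
      unfolding \<open>t = (\<lambda>i. \<theta> (i - 2)) ` I\<close> by (subst sum.reindex[OF inj]) simp
    finally have sum0: "(\<Sum>i\<in>I. of_int (u (\<theta> (i - 2))) * ln (real (pell i))) = 0" using t(3) by simp
    obtain i where i: "i \<in> I" "v = \<theta> (i - 2)" using t(4) \<open>t = (\<lambda>i. \<theta> (i - 2)) ` I\<close> by blast
    have "finite I" by (simp add: I_def)
    then have "u (\<theta> (i - 2)) = 0"
      using ln_pell_independent[OF _ _ sum0 i(1)] unfolding I_def by blast
    then show "u v = 0" by (simp only: i(2))
  qed
  have inj: "inj_on \<theta> {..<N}" unfolding \<theta>_def by (rule inj_on_ln_pell)
  have "\<epsilon> / (2 * pi) > 0" using \<open>\<epsilon> > 0\<close> by simp
  have "\<exists>t h. \<forall>i<N. \<bar>t * \<theta> i - of_int (h i) - (- Arg (z (Suc i)) / (2 * pi))\<bar> < \<epsilon> / (2 * pi)"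
    by (rule Kronecker_thm_1[OF indep inj \<open>\<epsilon> / (2 * pi) > 0\<close>, where \<alpha> = "\<lambda>i. - Arg (z (Suc i)) / (2 * pi)"])
       blast
  then obtain t h where
    th: "\<And>i. i < N \<Longrightarrow> \<bar>t * \<theta> i - of_int (h i) - (- Arg (z (Suc i)) / (2 * pi))\<bar> < \<epsilon> / (2 * pi)"
    by blast
  show ?thesis
  proof (rule that[of "2 * pi * t"])
    fix n assume "n \<le> N"
    show "norm (pell_phase (2 * pi * t) n - z n) < \<epsilon>"
    proof (cases n)
      case 0
      then show ?thesis using z(2) \<open>\<epsilon> > 0\<close> by (simp add: pell_phase_def)
    next
      case (Suc i)
      then have "i < N" using \<open>n \<le> N\<close> by simp
      define a where "a = - (2 * pi * t) * \<theta> i + 2 * pi * of_int (h i)"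
      have "pell_phase (2 * pi * t) n = cis (- (2 * pi * t) * \<theta> i)"
        by (simp add: pell_phase_def \<theta>_def Suc)
      also have "\<dots> = cis a"
        unfolding a_def cis_mult[symmetric] using cis_multiple_2pi[of "of_int (h i)"] by simp
      finally have ph: "pell_phase (2 * pi * t) n = cis a" .
      have zn: "z n = cis (Arg (z n))" using z(1)[of n]
        by (subst cis_Arg) (auto simp: sgn_div_norm)
      have "norm (pell_phase (2 * pi * t) n - z n) \<le> \<bar>a - Arg (z n)\<bar>"
        unfolding ph by (subst (1) zn) (rule norm_cis_diff_le)
      also have "a - Arg (z n) = - (2 * pi * (t * \<theta> i - of_int (h i) - (- Arg (z (Suc i)) / (2 * pi))))"
        unfolding a_def Suc by (simp add: field_simps)
      also have "\<bar>\<dots>\<bar> = 2 * pi * \<bar>t * \<theta> i - of_int (h i) - (- Arg (z (Suc i)) / (2 * pi))\<bar>"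
        unfolding abs_minus_cancel abs_mult by simp
      also have "\<dots> < 2 * pi * (\<epsilon> / (2 * pi))"
        by (intro mult_strict_left_mono th \<open>i < N\<close>) simp
      also have "\<dots> = \<epsilon>" by simp
      finally show ?thesis .
    qed
  qed
qed

section \<open>Series with modified coefficients\<close>

definition twisted_Z :: "(nat \<Rightarrow> complex) \<Rightarrow> complex \<Rightarrow> complex" where
  "twisted_Z c s = (\<Sum>n. c n * of_nat (pell (Suc n)) powr (- s))"

lemma norm_pell_powr: "norm (of_nat (pell (Suc n)) powr (- s) :: complex) = real (pell (Suc n)) powr (- Re s)"
  by (subst norm_powr_real_powr) auto

lemma pell_powr_mono:
  assumes "a \<le> b"
  shows "real (pell (Suc n)) powr (- b) \<le> real (pell (Suc n)) powr (- a)"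
  using assms pell_pos[of "Suc n"] by (intro powr_mono) auto

lemma twisted_term_bound:
  assumes "norm (c n) \<le> 1" "Re s \<ge> d"
  shows "norm (c n * of_nat (pell (Suc n)) powr (- s)) \<le> real (pell (Suc n)) powr (- d)"
  using mult_mono[OF assms(1) pell_powr_mono[OF assms(2), of n]] by (simp only: norm_mult norm_pell_powr) simp

lemma summable_twisted:
  assumes "\<And>n. norm (c n) \<le> 1" "Re s > 0"
  shows "summable (\<lambda>n. c n * of_nat (pell (Suc n)) powr (- s))"
  using twisted_term_bound[of c, OF assms(1) order.refl]
  by (intro summable_comparison_test'[OF summable_Z_real[OF assms(2)]]) auto

lemma twisted_Z_holomorphic:
  assumes "\<And>n. norm (c n) \<le> 1"
  shows "twisted_Z c holomorphic_on {s. Re s > 0}"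
proof (rule holomorphic_uniform_sequence)
  show "open {s. Re s > 0}" by (rule open_halfspace_Re_gt)
  show "(\<lambda>s. \<Sum>i<n. c i * of_nat (pell (Suc i)) powr (- s)) holomorphic_on {s. Re s > 0}" for n
    using pell_pos by (intro holomorphic_intros) auto
  fix s :: complex assume "s \<in> {s. Re s > 0}"
  then have s: "Re s > 0" by simp
  have sub: "Re w \<ge> Re s / 2" if "w \<in> cball s (Re s / 2)" for w
    using that abs_Re_le_cmod[of "s - w"] by (simp add: dist_norm)
  have "uniform_limit (cball s (Re s / 2)) (\<lambda>n s. \<Sum>i<n. c i * of_nat (pell (Suc i)) powr (- s)) (twisted_Z c) sequentially"
    unfolding twisted_Z_def[abs_def]
    by (rule Weierstrass_m_test[where M = "\<lambda>n. real (pell (Suc n)) powr (- (Re s / 2))"])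
       (use assms sub s summable_Z_real in \<open>auto intro!: twisted_term_bound\<close>)
  then show "\<exists>d. 0 < d \<and> cball s d \<subseteq> {s. Re s > 0} \<and>
      uniform_limit (cball s d) (\<lambda>n s. \<Sum>i<n. c i * of_nat (pell (Suc i)) powr (- s)) (twisted_Z c) sequentially"
    using s sub by (intro exI[of _ "Re s / 2"]) force
qed

text \<open>A translation by i t only multiplies the coefficients by phases, so a zero of the
  twisted series is a zero of \<open>Z_Pell\<close> with the same real part.\<close>

lemma Z_Pell_shift: "Z_Pell (s + \<i> * of_real t) = twisted_Z (pell_phase t) s"
proof -
  have "of_nat (pell (Suc n)) powr (- (s + \<i> * of_real t)) = pell_phase t n * of_nat (pell (Suc n)) powr (- s)" for n
  proof -
    have nz: "complex_of_nat (pell (Suc n)) \<noteq> 0" using pell_pos[of "Suc n"] by simp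
    then have "of_nat (pell (Suc n)) powr (- (s + \<i> * of_real t)) =
        of_nat (pell (Suc n)) powr (- (\<i> * of_real t)) * of_nat (pell (Suc n)) powr (- s)"
      by (simp only: minus_add_distrib powr_add mult.commute)
    also have "of_nat (pell (Suc n)) powr (- (\<i> * of_real t)) = pell_phase t n"
      using nz pell_pos[of "Suc n"] by (simp add: powr_def pell_phase_def cis_conv_exp Ln_of_nat mult_ac)
    finally show ?thesis .
  qed
  then show ?thesis by (simp only: Z_Pell_def twisted_Z_def)
qed

lemma Z_Pell_eq_twisted: "Z_Pell = twisted_Z (\<lambda>_. 1)"
  by (simp add: Z_Pell_def twisted_Z_def fun_eq_iff)

lemma Z_real_strict_antimono:
  assumes "0 < a" "a < b"
  shows "Z_real b < Z_real a"
proof -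
  note sm = summable_Z_real[of a] summable_Z_real[of b]
  have "0 < (\<Sum>n. real (pell (Suc n)) powr (- a) - real (pell (Suc n)) powr (- b))"
  \<comment> \<open>Index 1 belongs to P_2 = 2; the term of P_1 = 1 does not depend on the
    exponent.\<close>
  proof (rule suminf_pos2[of _ 1])
    show "summable (\<lambda>n. real (pell (Suc n)) powr (- a) - real (pell (Suc n)) powr (- b))"
      using assms by (intro summable_diff sm) auto
    show "0 \<le> real (pell (Suc n)) powr (- a) - real (pell (Suc n)) powr (- b)" for n
      using pell_powr_mono[of a b n] assms by simp
    show "0 < real (pell (Suc 1)) powr (- a) - real (pell (Suc 1)) powr (- b)"
      using assms by simp
  qed
  also have "\<dots> = Z_real a - Z_real b"
    unfolding Z_real_def using assms by (intro suminf_diff[symmetric] sm) auto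
  finally show ?thesis by simp
qed

text \<open>Shows that a twisted series has no zero where \<open>Z_real\<close> is below 2; this
  later rules out that the limit function vanishes identically.\<close>

lemma norm_twisted_Z_minus_one:
  assumes "\<And>n. norm (c n) \<le> 1" "c 0 = 1" "Re s > 0"
  shows "norm (twisted_Z c s - 1) \<le> Z_real (Re s) - 1"
proof -
  have "twisted_Z c s - 1 = (\<Sum>n. c (Suc n) * of_nat (pell (Suc (Suc n))) powr (- s))"
    unfolding twisted_Z_def using suminf_split_head[OF summable_twisted[of c, OF assms(1,3)]] assms(2)
    by (simp del: pell.simps(3))
  also have "norm \<dots> \<le> (\<Sum>n. real (pell (Suc (Suc n))) powr (- Re s))"
    using summable_Suc_iff[THEN iffD2, OF summable_Z_real[OF assms(3)]]
    by (intro norm_suminf_le twisted_term_bound assms order.refl)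
  also have "\<dots> = Z_real (Re s) - 1"
    unfolding Z_real_def using suminf_split_head[OF summable_Z_real[OF assms(3)]] by simp
  finally show ?thesis .
qed

text \<open>The hypotheses are the triangle inequalities for sides 1, X, Y. By the law of cosines,
  \<open>a\<close> is the real part of the unit vector v with |1 + X v| = Y; then w points back to
  the origin.\<close>

lemma triangle_phases:
  fixes X Y :: real
  assumes "X \<ge> 0" "Y \<ge> 0" "\<bar>X - Y\<bar> \<le> 1" "1 \<le> X + Y"
  obtains v w :: complex where "norm v = 1" "norm w = 1" "1 + of_real X * v + of_real Y * w = 0"
proof (cases "X = 0")
  case True
  then have "Y = 1" using assms by auto
  with True show ?thesis by (intro that[of 1 "-1"]) auto
next
  case False
  then have X: "X > 0" using assms by simp
  define a where "a = (Y\<^sup>2 - 1 - X\<^sup>2) / (2 * X)"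
  have "Y\<^sup>2 \<le> (1 + X)\<^sup>2" using assms by (intro power_mono) auto
  then have "a \<le> 1" using X by (simp add: a_def field_simps power2_eq_square)
  have "(1 - X)\<^sup>2 \<le> Y\<^sup>2" using assms by (intro abs_le_square_iff[THEN iffD1]) auto
  then have "a \<ge> -1" using X by (simp add: a_def field_simps power2_eq_square)
  have "a\<^sup>2 \<le> 1" using \<open>a \<le> 1\<close> \<open>a \<ge> -1\<close> by (simp add: abs_square_le_1 abs_le_iff)
  define v where "v = Complex a (sqrt (1 - a\<^sup>2))"
  have v: "norm v = 1" using \<open>a\<^sup>2 \<le> 1\<close> by (simp add: v_def cmod_def)
  have "(norm (1 + of_real X * v))\<^sup>2 = (1 + X * a)\<^sup>2 + (X * sqrt (1 - a\<^sup>2))\<^sup>2"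
    by (simp add: cmod_power2 v_def)
  also have "\<dots> = 1 + 2 * X * a + X\<^sup>2"
    using \<open>a\<^sup>2 \<le> 1\<close> by (simp add: power_mult_distrib) (simp add: power2_eq_square algebra_simps)
  also have "\<dots> = Y\<^sup>2" using X by (simp add: a_def)
  finally have nY: "norm (1 + of_real X * v) = Y" using assms(2) by (simp add: power2_eq_iff_nonneg)
  show ?thesis
  proof (cases "Y = 0")
    case True
    then show ?thesis using nY v by (intro that[of v 1]) auto
  next
    case False
    define z where "z = 1 + of_real X * v"
    have "norm (- (z / of_real Y)) = 1" using nY False assms(2) by (simp add: norm_divide flip: z_def)
    moreover have "z + of_real Y * (- (z / of_real Y)) = 0" using False by simp
    ultimately show ?thesis using v unfolding z_def by (intro that)
  qed
qed

text \<open>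
  The terms after the first are split into two blocks whose sums differ by at most 1; together with the
  leading 1 they are the sides of a triangle.
\<close>

lemma exists_vanishing_phases:
  assumes "x > 0" "Z_real x > 2"
  obtains c where "\<And>n. norm (c n) = 1" "c 0 = 1" "twisted_Z c (of_real x) = 0"
proof -
  define a where "a n = real (pell (Suc n)) powr (- x)" for n
  have a: "a 0 = 1" "a n > 0" "a n \<le> 1" for n
    using assms pell_powr_mono[of 0 x n] pell_pos[of "Suc n"] by (simp_all add: a_def)
  have sm: "summable a" unfolding a_def using assms by (intro summable_Z_real)
  define X where "X M = (\<Sum>n<M. a (Suc n))" for M
  define S where "S = Z_real x - 1"
  have S: "S = (\<Sum>n. a (Suc n))" "S > 1"
  proof -
    have "Z_real x = suminf a" by (simp only: Z_real_def a_def[abs_def])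
    then show "S = (\<Sum>n. a (Suc n))" using suminf_split_head[OF sm] a(1) by (simp only: S_def)
    show "S > 1" using assms(2) by (simp add: S_def)
  qed
  have X_lim: "X \<longlonglongrightarrow> S"
    unfolding X_def[abs_def] S(1) using sm by (intro summable_LIMSEQ) (simp add: summable_Suc_iff)
  have X_le: "X M \<le> S" for M
    unfolding X_def S(1) using sm a by (intro sum_le_suminf) (auto simp: summable_Suc_iff less_imp_le)
  have X_nonneg: "X M \<ge> 0" for M unfolding X_def using a by (intro sum_nonneg less_imp_le) auto
  have "eventually (\<lambda>M. X M > S - 1 / 2) sequentially"
    using X_lim by (rule order_tendstoD) simp
  then obtain M0 where "X M0 > S - 1 / 2" by (auto simp: eventually_sequentially)
  then have ex: "2 * X M0 - S \<ge> -1" using S by simp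
  \<comment> \<open>At the first M with 2 X_M - S \<ge> -1 the quantity has just risen from below -1
    by twice a term that is at most 1, so it is also at most 1.\<close>
  define M where "M = (LEAST M. 2 * X M - S \<ge> -1)"
  have M: "2 * X M - S \<ge> -1" unfolding M_def by (rule LeastI[of _ M0]) (rule ex)
  have "M \<noteq> 0" using M S by (intro notI) (simp add: X_def)
  then obtain M' where M': "M = Suc M'" using not0_implies_Suc by blast
  have "\<not> 2 * X M' - S \<ge> -1"
    using not_less_Least[of M' "\<lambda>M. 2 * X M - S \<ge> -1"] M' unfolding M_def by simp
  then have "2 * X M - S \<le> 1" using a(3)[of "Suc M'"] by (simp add: M' X_def)
  then obtain v w :: complex where vw: "norm v = 1" "norm w = 1" "1 + of_real (X M) * v + of_real (S - X M) * w = 0"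
    using M S(2) X_nonneg[of M] X_le[of M] by (auto intro: triangle_phases[of "X M" "S - X M"])
  define c where "c n = (if n = 0 then 1 else if n \<le> M then v else w)" for n
  have c: "norm (c n) = 1" for n using vw by (simp add: c_def)
  have pw: "of_nat (pell (Suc n)) powr (- of_real x) = complex_of_real (a n)" for n
    unfolding a_def by (subst powr_of_real[symmetric]) auto
  have smc: "summable (\<lambda>n. c n * of_real (a n))"
    using summable_twisted[of c "of_real x"] c assms by (simp add: pw)
  have "twisted_Z c (of_real x) = (\<Sum>n. c n * of_real (a n))" by (simp add: twisted_Z_def pw)
  also have "\<dots> = (\<Sum>n. c (n + Suc M) * of_real (a (n + Suc M))) + (\<Sum>n<Suc M. c n * of_real (a n))"
    by (rule suminf_split_initial_segment[OF smc])
  also have "(\<Sum>n<Suc M. c n * of_real (a n)) = 1 + of_real (X M) * v"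
    unfolding sum.lessThan_Suc_shift X_def using a
    by (simp add: c_def sum_distrib_right sum_distrib_left mult.commute)
  also have "(\<Sum>n. c (n + Suc M) * of_real (a (n + Suc M))) = of_real (S - X M) * w"
  proof -
    have "(\<Sum>n. a (Suc (n + M))) = S - X M"
      unfolding S(1) X_def using sm by (intro suminf_minus_initial_segment) (simp add: summable_Suc_iff)
    moreover have "summable (\<lambda>n. a (Suc (n + M)))"
      using sm summable_iff_shift[of a "Suc M"] by simp
    ultimately have "(\<lambda>n. a (Suc (n + M))) sums (S - X M)" by (simp only: sums_iff)
    then have "(\<lambda>n. complex_of_real (a (Suc (n + M))) * w) sums (of_real (S - X M) * w)"
      by (intro sums_mult2 sums_of_real)
    then have "(\<Sum>n. complex_of_real (a (Suc (n + M))) * w) = of_real (S - X M) * w"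
      by (rule sums_unique[symmetric])
    then show ?thesis by (simp add: c_def mult.commute)
  qed
  finally have "twisted_Z c (of_real x) = 0" using vw(3) by (simp add: algebra_simps)
  with c show ?thesis by (intro that[of c]) (auto simp: c_def)
qed

section \<open>Zeros\<close>

lemma continuous_on_Z_real: "continuous_on {0<..} Z_real"
proof -
  have "continuous_on {s. Re s > 0} Z_Pell"
    unfolding Z_Pell_eq_twisted by (intro holomorphic_on_imp_continuous_on twisted_Z_holomorphic) simp
  then have "continuous_on {0<..} (\<lambda>x. Z_Pell (of_real x))"
    by (rule continuous_on_compose2) (auto intro!: continuous_intros)
  then have "continuous_on {0<..} (\<lambda>x. Re (Z_Pell (of_real x)))"
    by (rule continuous_on_Re)
  then show ?thesis by (rule continuous_on_eq) (simp add: Z_Pell_of_real)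
qed

text \<open>Eliminating t gives an integer relation between ln P_2 and ln P_3. Oddness excludes t =
  0 and makes the coefficients nonzero.\<close>

lemma ln_2_ln_5_ratio:
  fixes m k :: int
  assumes "t * ln 2 = (2 * of_int m + 1) * pi" "t * ln 5 = (2 * of_int k + 1) * pi"
  shows False
proof -
  have "t \<noteq> 0"
  proof
    assume "t = 0"
    then have "real_of_int (2 * m + 1) = 0" using assms(1) by simp
    then have "2 * m + 1 = 0" by (simp only: of_int_eq_0_iff)
    then show False by presburger
  qed
  have "(2 * of_int k + 1) * (t * ln 2) = (2 * of_int m + 1) * (t * ln 5)"
    unfolding assms by (simp add: mult_ac)
  then have "t * ((2 * of_int k + 1) * ln 2 - (2 * of_int m + 1) * ln 5) = 0" by (simp add: algebra_simps)
  then have "(2 * of_int k + 1) * ln 2 - (2 * of_int m + 1) * ln 5 = (0::real)"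
    using \<open>t \<noteq> 0\<close> by (simp only: mult_eq_0_iff simp_thms)
  moreover have "pell 2 = 2" "pell 3 = 5" by (simp_all add: numeral_2_eq_2 numeral_3_eq_3)
  ultimately have "of_int (2 * k + 1) * ln (real (pell 2)) + of_int (- (2 * m + 1)) * ln (real (pell 3)) = 0"
    by (simp add: algebra_simps)
  then have "(\<Sum>i\<in>{2, 3}. of_int (if i = 2 then 2 * k + 1 else - (2 * m + 1)) * ln (real (pell i))) = 0"
    by simp
  then have "(if (2::nat) = 2 then 2 * k + 1 else - (2 * m + 1)) = 0"
    by (intro ln_pell_independent[where I = "{2, 3}" and c = "\<lambda>i. if i = 2 then 2 * k + 1 else - (2 * m + 1)" and i = 2]) auto
  then show False by simp presburger
qed

text \<open>
  On the boundary line the triangle inequality would have to be an equality, which aligns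
  the terms \<open>2\<^sup>-\<^sup>s\<close> and \<open>5\<^sup>-\<^sup>s\<close> with \<open>-1\<close>.
\<close>

lemma Z_Pell_nonzero:
  assumes "0 < Re s" "Z_real (Re s) \<le> 2"
  shows "Z_Pell s \<noteq> 0"
proof
  assume Z: "Z_Pell s = 0"
  define f where "f n = (of_nat (pell (Suc n)) powr (- s) :: complex)" for n
  define a where "a n = real (pell (Suc n)) powr (- Re s)" for n
  have nf: "norm (f n) = a n" for n unfolding f_def a_def by (rule norm_pell_powr)
  have sma: "summable a" unfolding a_def using assms(1) by (rule summable_Z_real)
  then have smf: "summable f" using nf by (intro summable_norm_cancel[of f]) simp
  have f0: "f 0 = 1" and a0: "a 0 = 1" by (simp_all add: f_def a_def)
  have "(\<Sum>n. f n) = 0" using Z by (simp add: Z_Pell_def f_def)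
  then have "(\<lambda>n. f (Suc n)) sums (- 1)" using smf f0 sums_Suc_iff[of f "-1"] by (auto simp: sums_iff)
  then have f': "(\<lambda>n. Re (f (Suc n))) sums (- 1)" using sums_Re by fastforce
  have a': "(\<lambda>n. a (Suc n)) sums (Z_real (Re s) - 1)"
    using summable_sums[OF sma] a0 sums_Suc_iff[of a "Z_real (Re s) - 1"] by (simp add: Z_real_def a_def[abs_def])
  have "(\<lambda>n. a (Suc n) + Re (f (Suc n))) sums (Z_real (Re s) - 1 + - 1)" by (rule sums_add[OF a' f'])
  then have le0: "(\<Sum>n. a (Suc n) + Re (f (Suc n))) \<le> 0" "summable (\<lambda>n. a (Suc n) + Re (f (Suc n)))"
    using assms(2) by (auto simp: sums_iff)
  \<comment> \<open>Nonnegative terms whose sum is Z(Re s) - 2 \<le> 0 must all vanish, so every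
    term after the first is a negative real.\<close>
  have nonneg: "0 \<le> a n + Re (f n)" for n
    using abs_Re_le_cmod[of "f n"] nf[of n] by linarith
  then have "(\<Sum>n. a (Suc n) + Re (f (Suc n))) = 0" using le0 suminf_nonneg[OF le0(2)] by force
  then have zero: "a (Suc n) + Re (f (Suc n)) = 0" for n
    using suminf_eq_zero_iff[OF le0(2)] nonneg by blast
  have cos: "cos (Im s * ln (real (pell (Suc (Suc n))))) = - 1" for n
  proof -
    have "s = of_real (Re s) + \<i> * of_real (Im s)" by (rule complex_eq)
    have pos: "pell (Suc (Suc n)) > 0" by (intro pell_pos) simp
    then have "f (Suc n) = exp (- s * of_real (ln (real (pell (Suc (Suc n))))))"
      unfolding f_def by (simp add: powr_def Ln_of_nat del: pell.simps)
    then have "Re (f (Suc n)) = exp (- Re s * ln (real (pell (Suc (Suc n))))) * cos (Im s * ln (real (pell (Suc (Suc n)))))"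
      by (simp add: Re_exp del: pell.simps)
    also have "exp (- Re s * ln (real (pell (Suc (Suc n))))) = a (Suc n)"
      unfolding a_def using pos by (simp add: powr_def del: pell.simps)
    finally have "a (Suc n) * (1 + cos (Im s * ln (real (pell (Suc (Suc n)))))) = 0"
      using zero[of n] by (simp add: algebra_simps del: pell.simps)
    moreover have "a (Suc n) \<noteq> 0" using pos by (simp add: a_def del: pell.simps)
    ultimately show ?thesis by (simp del: pell.simps)
  qed
  have "cos (Im s * ln 2) = - 1" "cos (Im s * ln 5) = - 1"
    using cos[of 0] cos[of 1] by simp_all
  then show False using ln_2_ln_5_ratio unfolding cos_eq_minus1 by blast
qed

text \<open>If no zero had real part within r of x, all the translates would be zero-free on a ball
  about x, and by Hurwitz so would their limit, which vanishes at x.\<close>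

lemma zero_near:
  assumes x: "x > 0" "Z_real x > 2" and "r > 0"
  obtains \<rho> where "Z_Pell \<rho> = 0" "Re \<rho> > 0" "\<bar>Re \<rho> - x\<bar> < r"
proof (rule ccontr)
  note found = that
  assume no: "\<not> thesis"
  obtain c where c: "\<And>n. norm (c n) = 1" "c 0 = 1" "twisted_Z c (of_real x) = 0"
    using exists_vanishing_phases[OF x] by blast
  have "\<exists>t. \<forall>n\<le>k. norm (pell_phase t n - c n) < 1 / real (Suc k)" for k
    using pell_phase_dense[of c "1 / real (Suc k)" k] c(1,2) by (metis of_nat_0_less_iff zero_less_Suc zero_less_divide_1_iff)
  then obtain t where t: "\<And>k n. n \<le> k \<Longrightarrow> norm (pell_phase (t k) n - c n) < 1 / real (Suc k)"
    by metis
  \<comment> \<open>The bound x / 2 keeps the ball in Re s \<ge> x / 2, where one summable majorant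
    serves all s.\<close>
  define d where "d = min r (x / 2)"
  have d: "d > 0" "d \<le> r" "d \<le> x / 2" using assms by (auto simp: d_def)
  define B where "B = ball (complex_of_real x) d"
  have Re_B: "\<bar>Re s - x\<bar> < d" if "s \<in> B" for s
    using that abs_Re_le_cmod[of "s - of_real x"] by (simp add: B_def dist_norm norm_minus_commute)
  then have B: "B \<subseteq> {s. Re s > 0}" "\<And>s. s \<in> B \<Longrightarrow> Re s \<ge> x / 2" using d by force+
  have nph: "norm (pell_phase t n) \<le> 1" for t n by (simp add: pell_phase_def)
  define M where "M n = real (pell (Suc n)) powr (- (x / 2))" for n
  have M: "summable M" "\<And>n. M n \<ge> 0" unfolding M_def using x by (auto intro: summable_Z_real)
  \<comment> \<open>This dominates the distance to the limit uniformly on the ball. The phases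
    converge only index by index, so its convergence to 0 relies on dominated convergence for
    series.\<close>
  define e where "e k = (\<Sum>n. norm (pell_phase (t k) n - c n) * M n)" for k
  have diff2: "norm (pell_phase (t k) n - c n) \<le> 2" for k n
    using norm_triangle_ineq4[of "pell_phase (t k) n" "c n"] nph[of "t k" n] c(1)[of n] by linarith
  have bound: "norm (norm (pell_phase (t k) n - c n) * M n) \<le> 2 * M n" for k n
    using mult_right_mono[OF diff2 M(2)] M(2) by simp
  have sme: "summable (\<lambda>n. norm (pell_phase (t k) n - c n) * M n)" for k
    using bound by (intro summable_comparison_test'[OF summable_mult[OF M(1), of 2]]) auto
  have ptw: "(\<lambda>k. norm (pell_phase (t k) n - c n) * M n) \<longlonglongrightarrow> 0" for n
  proof -
    have "(\<lambda>k. norm (pell_phase (t k) n - c n)) \<longlonglongrightarrow> 0"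
    proof (rule tendsto_sandwich[OF _ _ tendsto_const LIMSEQ_Suc[OF lim_1_over_n]])
      show "\<forall>\<^sub>F k in sequentially. norm (pell_phase (t k) n - c n) \<le> 1 / real (Suc k)"
        using eventually_ge_at_top[of n] by eventually_elim (use t in \<open>auto intro: less_imp_le\<close>)
    qed simp
    then show ?thesis by (rule tendsto_mult_left_zero)
  qed
  have e_lim: "e \<longlonglongrightarrow> 0"
  proof -
    have "(\<lambda>k. suminf (\<lambda>n. norm (pell_phase (t k) n - c n) * M n)) \<longlonglongrightarrow> suminf (\<lambda>n. 0 :: real)"
      by (rule tannerys_theorem[where M = "\<lambda>n. 2 * M n", THEN conjunct2, THEN conjunct2])
         (use ptw bound summable_mult[OF M(1)] in \<open>auto intro!: always_eventually\<close>)
    then show ?thesis by (simp add: e_def[abs_def])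
  qed
  have diff: "norm (twisted_Z (pell_phase (t k)) s - twisted_Z c s) \<le> e k" if "s \<in> B" for k s
  proof -
    have "Re s > 0" using that B(1) by auto
    then have "twisted_Z (pell_phase (t k)) s - twisted_Z c s =
        (\<Sum>n. (pell_phase (t k) n - c n) * of_nat (pell (Suc n)) powr (- s))"
      unfolding twisted_Z_def left_diff_distrib using nph c(1)
      by (intro suminf_diff summable_twisted) auto
    also have "norm \<dots> \<le> e k"
      unfolding e_def
    proof (rule norm_suminf_le[OF _ sme])
      fix n
      show "norm ((pell_phase (t k) n - c n) * of_nat (pell (Suc n)) powr (- s)) \<le> norm (pell_phase (t k) n - c n) * M n"
        unfolding norm_mult norm_pell_powr M_def using B(2)[OF that] by (intro mult_left_mono pell_powr_mono) auto
    qed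
    finally show ?thesis .
  qed
  have hol: "twisted_Z g holomorphic_on B" if "\<And>n. norm (g n) \<le> 1" for g
    using twisted_Z_holomorphic[OF that] B(1) by (rule holomorphic_on_subset)
  have "twisted_Z c (of_real x) \<noteq> 0"
  proof (rule Hurwitz_no_zeros[of B "\<lambda>k. twisted_Z (pell_phase (t k))" "twisted_Z c"])
    show "open B" "connected B" "complex_of_real x \<in> B" using d by (simp_all add: B_def)
    show "twisted_Z (pell_phase (t k)) holomorphic_on B" for k using nph by (intro hol)
    show "twisted_Z c holomorphic_on B" using c(1) by (intro hol) simp
    show "uniform_limit K (\<lambda>k. twisted_Z (pell_phase (t k))) (twisted_Z c) sequentially" if "K \<subseteq> B" for K
    proof (rule uniform_limitI)
      fix \<epsilon> :: real assume "\<epsilon> > 0"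
      with e_lim have "\<forall>\<^sub>F k in sequentially. e k < \<epsilon>" by (rule order_tendstoD)
      then show "\<forall>\<^sub>F k in sequentially. \<forall>s\<in>K. dist (twisted_Z (pell_phase (t k)) s) (twisted_Z c s) < \<epsilon>"
      proof eventually_elim
        case (elim k)
        show ?case
          unfolding dist_norm using diff[of _ k] \<open>K \<subseteq> B\<close> elim by (meson order.strict_trans1 subsetD)
      qed
    qed
    show "twisted_Z (pell_phase (t k)) s \<noteq> 0" if "s \<in> B" for k s
    proof
      assume "twisted_Z (pell_phase (t k)) s = 0"
      then have "Z_Pell (s + \<i> * of_real (t k)) = 0" by (simp add: Z_Pell_shift)
      moreover have "Re (s + \<i> * of_real (t k)) = Re s" by simp
      ultimately show False using no found[of "s + \<i> * of_real (t k)"] Re_B[OF \<open>s \<in> B\<close>] B(1) \<open>s \<in> B\<close> d by force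
    qed
    show "\<not> twisted_Z c constant_on B"
    proof
      assume "twisted_Z c constant_on B"
      then have zero: "twisted_Z c s = 0" if "s \<in> B" for s
        using c(3) \<open>complex_of_real x \<in> B\<close> that by (metis constant_on_def)
      \<comment> \<open>At this point \<open>Z_real\<close> is below 2, so the twisted series is
        nonzero there. The point may lie outside the ball; the identity theorem carries the supposed
        vanishing to the whole half-plane.\<close>
      define w :: real where "w = 0.875850904477574106444461159948"
      have "twisted_Z c (of_real w) = 0"
      proof (rule analytic_continuation[of "twisted_Z c" "{s. Re s > 0}" B "of_real x"])
        show "twisted_Z c holomorphic_on {s. Re s > 0}" using c(1) by (intro twisted_Z_holomorphic) simp
        show "connected {s. Re s > 0}" by (intro convex_connected convex_halfspace_Re_gt)
        show "complex_of_real x islimpt B"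
          using \<open>open B\<close> \<open>complex_of_real x \<in> B\<close> by (metis interior_limit_point interior_open)
      qed (use B(1) x zero in \<open>auto simp: open_halfspace_Re_gt w_def\<close>)
      moreover have "norm (twisted_Z c (of_real w) - 1) \<le> Z_real w - 1"
        using norm_twisted_Z_minus_one[of c "of_real w"] c(1,2) by (simp add: w_def)
      ultimately show False using Z_real_at_upper by (simp add: w_def)
    qed
  qed
  with c(3) show False by simp
qed

theorem corollary5p3:
  shows "(\<exists>!\<sigma>::real. \<sigma> > 0 \<and> Z_Pell (of_real \<sigma>) = 2) \<and>
    (\<forall>\<sigma>::real. \<sigma> > 0 \<and> Z_Pell (of_real \<sigma>) = 2 \<longrightarrow>
      0.875850904477574106444461159947 \<le> \<sigma> \<and> \<sigma> < 0.875850904477574106444461159948 \<and>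
      (\<forall>s. Re s \<ge> \<sigma> \<longrightarrow> Z_Pell s \<noteq> 0) \<and>
      closure {Re \<rho> |\<rho>. Z_Pell \<rho> = 0 \<and> Re \<rho> > 0} = {0..\<sigma>} \<and>
      (\<forall>s. Re s = \<sigma> \<longrightarrow> Z_Pell s \<noteq> 0))"
proof -
  define a b :: real where "a = 0.875850904477574106444461159947" and "b = 0.875850904477574106444461159948"
  have ab: "0 < a" "a < b" by (simp_all add: a_def b_def)
  have Za: "Z_real a > 2" and Zb: "Z_real b < 2"
    using Z_real_at_lower Z_real_at_upper by (simp_all add: a_def b_def)
  have iff: "Z_Pell (of_real \<sigma>) = 2 \<longleftrightarrow> Z_real \<sigma> = 2" if "\<sigma> > 0" for \<sigma>
    unfolding Z_Pell_of_real[OF that] by (metis of_real_eq_iff of_real_numeral)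
  have anti: "Z_real y \<le> Z_real x" if "0 < x" "x \<le> y" for x y
    using Z_real_strict_antimono[of x y] that by (cases "x = y") auto
  have "\<exists>\<sigma>\<ge>a. \<sigma> \<le> b \<and> Z_real \<sigma> = 2"
    using ab Za Zb by (intro IVT2' continuous_on_subset[OF continuous_on_Z_real]) auto
  then obtain \<sigma>0 where "\<sigma>0 \<ge> a" "Z_real \<sigma>0 = 2" by blast
  then have ex: "\<sigma>0 > 0 \<and> Z_Pell (of_real \<sigma>0) = 2" using ab iff by simp
  have uniq: "\<sigma> = \<tau>" if "\<sigma> > 0 \<and> Z_Pell (of_real \<sigma>) = 2" "\<tau> > 0 \<and> Z_Pell (of_real \<tau>) = 2" for \<sigma> \<tau>
    using that iff Z_real_strict_antimono[of \<sigma> \<tau>] Z_real_strict_antimono[of \<tau> \<sigma>] by (cases \<sigma> \<tau> rule: linorder_cases) auto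
  have "a \<le> \<sigma> \<and> \<sigma> < b \<and> (\<forall>s. Re s \<ge> \<sigma> \<longrightarrow> Z_Pell s \<noteq> 0) \<and>
      closure {Re \<rho> |\<rho>. Z_Pell \<rho> = 0 \<and> Re \<rho> > 0} = {0..\<sigma>} \<and> (\<forall>s. Re s = \<sigma> \<longrightarrow> Z_Pell s \<noteq> 0)"
    if \<sigma>: "\<sigma> > 0 \<and> Z_Pell (of_real \<sigma>) = 2" for \<sigma>
  proof -
    have Z\<sigma>: "Z_real \<sigma> = 2" "\<sigma> > 0" using \<sigma> iff by auto
    have "a \<le> \<sigma>" using anti[of \<sigma> a] Za Z\<sigma> by force
    moreover have "\<sigma> < b" using anti[of b \<sigma>] Zb Z\<sigma> ab by force
    moreover have nz: "Z_Pell s \<noteq> 0" if "Re s \<ge> \<sigma>" for s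
      using anti[of \<sigma> "Re s"] Z\<sigma> that by (intro Z_Pell_nonzero) auto
    moreover have "closure {Re \<rho> |\<rho>. Z_Pell \<rho> = 0 \<and> Re \<rho> > 0} = {0..\<sigma>}" (is "closure ?R = _")
    proof
      have "?R \<subseteq> {0..\<sigma>}" using nz by (force simp: not_le)
      then show "closure ?R \<subseteq> {0..\<sigma>}" by (intro closure_minimal) auto
      have "{0<..<\<sigma>} \<subseteq> closure ?R"
      proof
        fix x assume x: "x \<in> {0<..<\<sigma>}"
        then have "Z_real x > 2" using Z_real_strict_antimono[of x \<sigma>] Z\<sigma> by simp
        show "x \<in> closure ?R"
          unfolding closure_approachable
        proof (intro allI impI)
          fix r :: real assume "r > 0"
          then obtain \<rho> where "Z_Pell \<rho> = 0" "Re \<rho> > 0" "\<bar>Re \<rho> - x\<bar> < r"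
            using zero_near[of x r] x \<open>Z_real x > 2\<close> by auto
          then show "\<exists>y\<in>?R. dist y x < r" by (auto simp: dist_real_def)
        qed
      qed
      then have "closure {0<..<\<sigma>} \<subseteq> closure ?R" by (intro closure_minimal) auto
      then show "{0..\<sigma>} \<subseteq> closure ?R" using Z\<sigma> by simp
    qed
    ultimately show ?thesis by auto
  qed
  then show ?thesis using ex uniq unfolding a_def b_def by blast
qed

end
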